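(* Let $(L:\mathcal C\to\mathcal C,\ R:\mathcal C\to\mathcal C)$ be an adjoint pair of functors ($L$ left adjoint to $R$). Suppose that $\mathbf L=(L,\Delta,\epsilon)$ is a comonad, with corresponding monad structure $\mathbf R=(R,\ \mu:=\overline{\Delta},\ \iota:=\overline{\epsilon})$ on $R$. Let $(I:\mathcal C\to\mathcal C,\ J:\mathcal C\to\mathcal C)$ be any adjoint pair ($I$ left adjoint to $J$) such that $I$ commutes with the comonad structure on $L$, i.e. $$IL=LI,\qquad I\Delta=\Delta I,\qquad I\epsilon=\epsilon I.$$ Then: (1) $F^{\mathbf L}$ is $I$-separable if and only if $F_{\mathbf R}$ is $J$-separable. (2) If $I$ or $J$ is full, then $F^{\mathbf L}$ is heavily $I$-separable if and only if $F_{\mathbf R}$ is heavily $J$-separable. (3) Let $(P:\mathcal C\to\mathcal A,\ Q':\mathcal A\to\mathcal C)$ be an adjunction ($P$ left adjoint) with associated monad $\mathbf R$ and let $(P':\mathcal B\to\mathcal C,\ Q:\mathcal C\to\mathcal B)$ be an adjunction ($P'$ left adjoint) with associated comonad $\mathbf L$. If $I$ or $J$ is full, then $Q$ is heavily $I$-separable if and only if $P$ is heavily $J$-separable.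
   Context: Definition. Let $F:\mathcal C\to\mathcal D$ and $I:\mathcal C\to\mathcal X$ be functors. $F$ is $I$-separable if there is a natural transformation $P:\mathcal D(F(-),F(-))\to\mathcal X(I(-),I(-))$ of functors $\mathcal C^{op}\times\mathcal C\to \mathrm{Set}$ such that (a) $P_{a,b}(F(f))=I(f)$ for all $f\in\mathcal C(a,b)$. $F$ is heavily $I$-separable if such a $P$ can be chosen so that moreover (b) $P_{a,c}(g\circ f)=P_{b,c}(g)\circ P_{a,b}(f)$ for all $f\in\mathcal D(Fa,Fb)$, $g\in\mathcal D(Fb,Fc)$. Mates: if $(F_1,G_1)$ and $(F_2,G_2)$ are adjoint pairs $\mathcal C\rightleftarrows\mathcal D$ with units $\eta_i$ and counits $\varepsilon_i$, a natural transformation $\alpha:F_1\to F_2$ corresponds bijectively to $\overline\alpha:=G_1\varepsilon_2\circ G_1\alpha G_2\circ\eta_1G_2:G_2\to G_1$. Applied to $\Delta:L\to LL$ and $\epsilon:L\to 1_{\mathcal C}$, with the composite adjunction $(LL,RR)$ and the identity adjunction, this gives $\overline\Delta:RR\to R$ and $\overline\epsilon:1_{\mathcal C}\to R$, which make $R$ a monad. For a monad $\mathbf R=(R,\mu,\iota)$ on $\mathcal C$, $\mathcal C_{\mathbf R}$ is the Eilenberg–Moore category of $\mathbf R$-algebras and $F_{\mathbf R}:\mathcal C\to\mathcal C_{\mathbf R}$, $x\mapsto(Rx,\mu_x)$, is the free algebra functor. For a comonad $\mathbf L=(L,\Delta,\epsilon)$ on $\mathcal C$, $\mathcal C^{\mathbf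 L}$ is the Eilenberg–Moore category of $\mathbf L$-coalgebras and $F^{\mathbf L}:\mathcal C\to\mathcal C^{\mathbf L}$, $x\mapsto(Lx,\Delta_x)$, is the (co)free coalgebra functor. The monad associated to an adjunction $(F,G)$ with unit $\eta$ and counit $\varepsilon$ is $(GF,G\varepsilon F,\eta)$; the associated comonad is $(FG,F\eta G,\varepsilon)$. *)

theory Defs
  imports "HOL-Library.FuncSet"
begin

section \<open>Categories, functors, natural transformations\<close>

text \<open>Composition is written in the usual order: \<open>g \<cdot>\<^bsub>C\<^esub> f\<close> is ``first f, then g'';
  it is meaningful only for composable arrows of C.\<close>

record ('o, 'm) category =
  Obj :: "'o set"
  Arr :: "'m set"
  Dom :: "'m \<Rightarrow> 'o"
  Cod :: "'m \<Rightarrow> 'o"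
  Id :: "'o \<Rightarrow> 'm"
  Comp :: "'m \<Rightarrow> 'm \<Rightarrow> 'm"  (infixl "\<cdot>\<index>" 70)

definition Hom :: "('o, 'm) category \<Rightarrow> 'o \<Rightarrow> 'o \<Rightarrow> 'm set" where
  "Hom C a b = {f \<in> Arr C. Dom C f = a \<and> Cod C f = b}"

locale category =
  fixes C :: "('o, 'm) category" (structure)
  assumes Dom_Obj: "f \<in> Arr C \<Longrightarrow> Dom C f \<in> Obj C"
    and Cod_Obj: "f \<in> Arr C \<Longrightarrow> Cod C f \<in> Obj C"
    and Id_Hom: "a \<in> Obj C \<Longrightarrow> Id C a \<in> Hom C a a"
    and Comp_Hom: "f \<in> Hom C a b \<Longrightarrow> g \<in> Hom C b c \<Longrightarrow> g \<cdot> f \<in> Hom C a c"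
    and Comp_Id: "f \<in> Hom C a b \<Longrightarrow> f \<cdot> Id C a = f"
    and Id_Comp: "f \<in> Hom C a b \<Longrightarrow> Id C b \<cdot> f = f"
    and Comp_assoc: "f \<in> Hom C a b \<Longrightarrow> g \<in> Hom C b c \<Longrightarrow> h \<in> Hom C c d
      \<Longrightarrow> (h \<cdot> g) \<cdot> f = h \<cdot> (g \<cdot> f)"

record ('o1, 'm1, 'o2, 'm2) cat_functor =
  map_obj :: "'o1 \<Rightarrow> 'o2"
  map_arr :: "'m1 \<Rightarrow> 'm2"

locale cat_functor = C: category C + D: category D
  for C :: "('o1, 'm1) category" and D :: "('o2, 'm2) category" +
  fixes F :: "('o1, 'm1, 'o2, 'm2) cat_functor"
  assumes map_obj_Obj: "a \<in> Obj C \<Longrightarrow> map_obj F a \<in> Obj D"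
    and map_arr_Hom: "f \<in> Hom C a b \<Longrightarrow> map_arr F f \<in> Hom D (map_obj F a) (map_obj F b)"
    and map_arr_Id: "a \<in> Obj C \<Longrightarrow> map_arr F (Id C a) = Id D (map_obj F a)"
    and map_arr_Comp: "f \<in> Hom C a b \<Longrightarrow> g \<in> Hom C b c
      \<Longrightarrow> map_arr F (g \<cdot>\<^bsub>C\<^esub> f) = map_arr F g \<cdot>\<^bsub>D\<^esub> map_arr F f"

definition id_functor :: "('o, 'm, 'o, 'm) cat_functor" where
  "id_functor = \<lparr>map_obj = (\<lambda>x. x), map_arr = (\<lambda>f. f)\<rparr>"

definition comp_functor ::
  "('o2, 'm2, 'o3, 'm3) cat_functor \<Rightarrow> ('o1, 'm1, 'o2, 'm2) cat_functor
    \<Rightarrow> ('o1, 'm1, 'o3, 'm3) cat_functor"  (infixr "\<odot>" 75) where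
  "G \<odot> F = \<lparr>map_obj = (\<lambda>x. map_obj G (map_obj F x)), map_arr = (\<lambda>f. map_arr G (map_arr F f))\<rparr>"

text \<open>HOL functions are total, so equality of functors out of C means agreement on the
  objects and arrows of C only.\<close>

definition functor_eq ::
  "('o1, 'm1) category \<Rightarrow> ('o1, 'm1, 'o2, 'm2) cat_functor
    \<Rightarrow> ('o1, 'm1, 'o2, 'm2) cat_functor \<Rightarrow> bool" where
  "functor_eq C F G \<longleftrightarrow>
    (\<forall>x\<in>Obj C. map_obj F x = map_obj G x) \<and> (\<forall>f\<in>Arr C. map_arr F f = map_arr G f)"

definition full_functor ::
  "('o1, 'm1) category \<Rightarrow> ('o2, 'm2) category \<Rightarrow> ('o1, 'm1, 'o2, 'm2) cat_functor \<Rightarrow> bool" where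
  "full_functor C D F \<longleftrightarrow>
    (\<forall>a\<in>Obj C. \<forall>b\<in>Obj C. \<forall>g\<in>Hom D (map_obj F a) (map_obj F b). \<exists>f\<in>Hom C a b. map_arr F f = g)"

locale nat_transf = F: cat_functor C D F + G: cat_functor C D G
  for C :: "('o1, 'm1) category" and D :: "('o2, 'm2) category"
    and F G :: "('o1, 'm1, 'o2, 'm2) cat_functor" +
  fixes \<alpha> :: "'o1 \<Rightarrow> 'm2"
  assumes component: "a \<in> Obj C \<Longrightarrow> \<alpha> a \<in> Hom D (map_obj F a) (map_obj G a)"
    and naturality: "f \<in> Hom C a b \<Longrightarrow> \<alpha> b \<cdot>\<^bsub>D\<^esub> map_arr F f = map_arr G f \<cdot>\<^bsub>D\<^esub> \<alpha> a"


section \<open>Adjunctions and mates\<close>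

record ('o1, 'm1, 'o2, 'm2) adjunction =
  ladj :: "('o1, 'm1, 'o2, 'm2) cat_functor"
  radj :: "('o2, 'm2, 'o1, 'm1) cat_functor"
  adj_unit :: "'o1 \<Rightarrow> 'm1"
  adj_counit :: "'o2 \<Rightarrow> 'm2"

locale adjunction =
  fixes C :: "('o1, 'm1) category" and D :: "('o2, 'm2) category"
    and A :: "('o1, 'm1, 'o2, 'm2) adjunction"
  assumes ladj_functor: "cat_functor C D (ladj A)"
    and radj_functor: "cat_functor D C (radj A)"
    and unit_nat: "nat_transf C C id_functor (radj A \<odot> ladj A) (adj_unit A)"
    and counit_nat: "nat_transf D D (ladj A \<odot> radj A) id_functor (adj_counit A)"
    and triangle_ladj: "x \<in> Obj C \<Longrightarrow>
      adj_counit A (map_obj (ladj A) x) \<cdot>\<^bsub>D\<^esub> map_arr (ladj A) (adj_unit A x)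
        = Id D (map_obj (ladj A) x)"
    and triangle_radj: "y \<in> Obj D \<Longrightarrow>
      map_arr (radj A) (adj_counit A y) \<cdot>\<^bsub>C\<^esub> adj_unit A (map_obj (radj A) y)
        = Id C (map_obj (radj A) y)"

definition id_adjunction :: "('o, 'm) category \<Rightarrow> ('o, 'm, 'o, 'm) adjunction" where
  "id_adjunction C =
    \<lparr>ladj = id_functor, radj = id_functor, adj_unit = Id C, adj_counit = Id C\<rparr>"

text \<open>For \<open>A1\<close> between C and D and \<open>A2\<close> between D and E: the composite adjunction
  \<open>F2 F1 \<stileturn> G1 G2\<close>, with unit \<open>G1 \<eta>2 F1 \<circ> \<eta>1\<close> and counit \<open>\<epsilon>2 \<circ> F2 \<epsilon>1 G2\<close>.\<close>

definition comp_adjunction ::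
  "('o1, 'm1) category \<Rightarrow> ('o3, 'm3) category \<Rightarrow> ('o2, 'm2, 'o3, 'm3) adjunction
    \<Rightarrow> ('o1, 'm1, 'o2, 'm2) adjunction \<Rightarrow> ('o1, 'm1, 'o3, 'm3) adjunction" where
  "comp_adjunction C E A2 A1 =
    \<lparr>ladj = ladj A2 \<odot> ladj A1,
     radj = radj A1 \<odot> radj A2,
     adj_unit = (\<lambda>x. map_arr (radj A1) (adj_unit A2 (map_obj (ladj A1) x)) \<cdot>\<^bsub>C\<^esub> adj_unit A1 x),
     adj_counit = (\<lambda>y. adj_counit A2 y
        \<cdot>\<^bsub>E\<^esub> map_arr (ladj A2) (adj_counit A1 (map_obj (radj A2) y)))\<rparr>"

text \<open>The mate \<open>G1 \<epsilon>2 \<circ> G1 \<alpha> G2 \<circ> \<eta>1 G2 : G2 \<rightarrow> G1\<close> of \<open>\<alpha> : F1 \<rightarrow> F2\<close>, where \<open>A1\<close>, \<open>A2\<close> are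
  adjunctions from C to D.\<close>

definition mate ::
  "('o1, 'm1) category \<Rightarrow> ('o1, 'm1, 'o2, 'm2) adjunction \<Rightarrow> ('o1, 'm1, 'o2, 'm2) adjunction
    \<Rightarrow> ('o1 \<Rightarrow> 'm2) \<Rightarrow> 'o2 \<Rightarrow> 'm1" where
  "mate C A1 A2 \<alpha> = (\<lambda>y. map_arr (radj A1) (adj_counit A2 y)
      \<cdot>\<^bsub>C\<^esub> map_arr (radj A1) (\<alpha> (map_obj (radj A2) y))
      \<cdot>\<^bsub>C\<^esub> adj_unit A1 (map_obj (radj A2) y))"


section \<open>Comonads, (co)algebras, (co)free functors\<close>

locale comonad =
  fixes C :: "('o, 'm) category" and L :: "('o, 'm, 'o, 'm) cat_functor"
    and \<Delta> \<epsilon> :: "'o \<Rightarrow> 'm"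
  assumes comult_nat: "nat_transf C C L (L \<odot> L) \<Delta>"
    and counit_nat: "nat_transf C C L id_functor \<epsilon>"
    and coassoc: "x \<in> Obj C \<Longrightarrow> map_arr L (\<Delta> x) \<cdot>\<^bsub>C\<^esub> \<Delta> x = \<Delta> (map_obj L x) \<cdot>\<^bsub>C\<^esub> \<Delta> x"
    and counit_left: "x \<in> Obj C \<Longrightarrow> \<epsilon> (map_obj L x) \<cdot>\<^bsub>C\<^esub> \<Delta> x = Id C (map_obj L x)"
    and counit_right: "x \<in> Obj C \<Longrightarrow> map_arr L (\<epsilon> x) \<cdot>\<^bsub>C\<^esub> \<Delta> x = Id C (map_obj L x)"

text \<open>An arrow of the Eilenberg-Moore categories is a triple of source, underlying arrow of C
  and target: the same arrow of C can be a morphism between different (co)algebras.\<close>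

definition EM_coalg ::
  "('o, 'm) category \<Rightarrow> ('o, 'm, 'o, 'm) cat_functor \<Rightarrow> ('o \<Rightarrow> 'm) \<Rightarrow> ('o \<Rightarrow> 'm)
    \<Rightarrow> ('o \<times> 'm, ('o \<times> 'm) \<times> 'm \<times> ('o \<times> 'm)) category" where
  "EM_coalg C L \<Delta> \<epsilon> = (let Ob = {(x, h). x \<in> Obj C \<and> h \<in> Hom C x (map_obj L x)
         \<and> \<epsilon> x \<cdot>\<^bsub>C\<^esub> h = Id C x \<and> \<Delta> x \<cdot>\<^bsub>C\<^esub> h = map_arr L h \<cdot>\<^bsub>C\<^esub> h} in
    \<lparr>Obj = Ob,
     Arr = {((x, h), f, (y, k)) | x h f y k. (x, h) \<in> Ob \<and> (y, k) \<in> Ob \<and> f \<in> Hom C x y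
         \<and> k \<cdot>\<^bsub>C\<^esub> f = map_arr L f \<cdot>\<^bsub>C\<^esub> h},
     Dom = (\<lambda>(s, f, t). s),
     Cod = (\<lambda>(s, f, t). t),
     Id = (\<lambda>s. (s, Id C (fst s), s)),
     Comp = (\<lambda>(t, g, u) (s, f, t'). (s, g \<cdot>\<^bsub>C\<^esub> f, u))\<rparr>)"

definition cofree_coalg ::
  "('o, 'm, 'o, 'm) cat_functor \<Rightarrow> ('o \<Rightarrow> 'm) \<Rightarrow> ('o, 'm) category
    \<Rightarrow> ('o, 'm, 'o \<times> 'm, ('o \<times> 'm) \<times> 'm \<times> ('o \<times> 'm)) cat_functor" where
  "cofree_coalg L \<Delta> C =
    \<lparr>map_obj = (\<lambda>x. (map_obj L x, \<Delta> x)),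
     map_arr = (\<lambda>f. ((map_obj L (Dom C f), \<Delta> (Dom C f)), map_arr L f,
                     (map_obj L (Cod C f), \<Delta> (Cod C f))))\<rparr>"

definition EM_alg ::
  "('o, 'm) category \<Rightarrow> ('o, 'm, 'o, 'm) cat_functor \<Rightarrow> ('o \<Rightarrow> 'm) \<Rightarrow> ('o \<Rightarrow> 'm)
    \<Rightarrow> ('o \<times> 'm, ('o \<times> 'm) \<times> 'm \<times> ('o \<times> 'm)) category" where
  "EM_alg C R \<mu> \<iota> = (let Ob = {(x, h). x \<in> Obj C \<and> h \<in> Hom C (map_obj R x) x
         \<and> h \<cdot>\<^bsub>C\<^esub> \<iota> x = Id C x \<and> h \<cdot>\<^bsub>C\<^esub> \<mu> x = h \<cdot>\<^bsub>C\<^esub> map_arr R h} in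
    \<lparr>Obj = Ob,
     Arr = {((x, h), f, (y, k)) | x h f y k. (x, h) \<in> Ob \<and> (y, k) \<in> Ob \<and> f \<in> Hom C x y
         \<and> f \<cdot>\<^bsub>C\<^esub> h = k \<cdot>\<^bsub>C\<^esub> map_arr R f},
     Dom = (\<lambda>(s, f, t). s),
     Cod = (\<lambda>(s, f, t). t),
     Id = (\<lambda>s. (s, Id C (fst s), s)),
     Comp = (\<lambda>(t, g, u) (s, f, t'). (s, g \<cdot>\<^bsub>C\<^esub> f, u))\<rparr>)"

definition free_alg ::
  "('o, 'm, 'o, 'm) cat_functor \<Rightarrow> ('o \<Rightarrow> 'm) \<Rightarrow> ('o, 'm) category
    \<Rightarrow> ('o, 'm, 'o \<times> 'm, ('o \<times> 'm) \<times> 'm \<times> ('o \<times> 'm)) cat_functor" where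
  "free_alg R \<mu> C =
    \<lparr>map_obj = (\<lambda>x. (map_obj R x, \<mu> x)),
     map_arr = (\<lambda>f. ((map_obj R (Dom C f), \<mu> (Dom C f)), map_arr R f,
                     (map_obj R (Cod C f), \<mu> (Cod C f))))\<rparr>"

text \<open>For an adjunction \<open>F \<stileturn> G\<close> from C to D: the associated monad \<open>(GF, G\<epsilon>F, \<eta>)\<close> on C is
  \<open>(R, \<mu>, \<iota>)\<close>, respectively the associated comonad \<open>(FG, F\<eta>G, \<epsilon>)\<close> on D is \<open>(L, \<Delta>, e)\<close>.\<close>

definition has_monad ::
  "('o1, 'm1) category \<Rightarrow> ('o1, 'm1, 'o2, 'm2) adjunction
    \<Rightarrow> ('o1, 'm1, 'o1, 'm1) cat_functor \<Rightarrow> ('o1 \<Rightarrow> 'm1) \<Rightarrow> ('o1 \<Rightarrow> 'm1) \<Rightarrow> bool" where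
  "has_monad C A R \<mu> \<iota> \<longleftrightarrow>
    functor_eq C (radj A \<odot> ladj A) R \<and>
    (\<forall>x\<in>Obj C. map_arr (radj A) (adj_counit A (map_obj (ladj A) x)) = \<mu> x) \<and>
    (\<forall>x\<in>Obj C. adj_unit A x = \<iota> x)"

definition has_comonad ::
  "('o2, 'm2) category \<Rightarrow> ('o1, 'm1, 'o2, 'm2) adjunction
    \<Rightarrow> ('o2, 'm2, 'o2, 'm2) cat_functor \<Rightarrow> ('o2 \<Rightarrow> 'm2) \<Rightarrow> ('o2 \<Rightarrow> 'm2) \<Rightarrow> bool" where
  "has_comonad D A L \<Delta> e \<longleftrightarrow>
    functor_eq D (ladj A \<odot> radj A) L \<and>
    (\<forall>y\<in>Obj D. map_arr (ladj A) (adj_unit A (map_obj (radj A) y)) = \<Delta> y) \<and>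
    (\<forall>y\<in>Obj D. adj_counit A y = e y)"


section \<open>Relative separability\<close>

text \<open>Natural transformations \<open>D(F-,F-) \<rightarrow> X(I-,I-)\<close> of functors from \<open>C\<^sup>o\<^sup>p \<times> C\<close> to Set: the
  family of maps is indexed by objects of C, as F need not be injective on objects.\<close>

definition hom_transf ::
  "('o1, 'm1) category \<Rightarrow> ('o2, 'm2) category \<Rightarrow> ('o3, 'm3) category
    \<Rightarrow> ('o1, 'm1, 'o2, 'm2) cat_functor \<Rightarrow> ('o1, 'm1, 'o3, 'm3) cat_functor
    \<Rightarrow> ('o1 \<Rightarrow> 'o1 \<Rightarrow> 'm2 \<Rightarrow> 'm3) \<Rightarrow> bool" where
  "hom_transf C D X F I P \<longleftrightarrow>
    (\<forall>a\<in>Obj C. \<forall>b\<in>Obj C.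
      P a b \<in> Hom D (map_obj F a) (map_obj F b) \<rightarrow> Hom X (map_obj I a) (map_obj I b)) \<and>
    (\<forall>a\<in>Obj C. \<forall>b\<in>Obj C. \<forall>a'\<in>Obj C. \<forall>b'\<in>Obj C. \<forall>u\<in>Hom C a' a. \<forall>v\<in>Hom C b b'.
      \<forall>f\<in>Hom D (map_obj F a) (map_obj F b).
        P a' b' (map_arr F v \<cdot>\<^bsub>D\<^esub> f \<cdot>\<^bsub>D\<^esub> map_arr F u)
          = map_arr I v \<cdot>\<^bsub>X\<^esub> P a b f \<cdot>\<^bsub>X\<^esub> map_arr I u)"

definition splits_arrows ::
  "('o1, 'm1) category \<Rightarrow> ('o1, 'm1, 'o2, 'm2) cat_functor \<Rightarrow> ('o1, 'm1, 'o3, 'm3) cat_functor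
    \<Rightarrow> ('o1 \<Rightarrow> 'o1 \<Rightarrow> 'm2 \<Rightarrow> 'm3) \<Rightarrow> bool" where
  "splits_arrows C F I P \<longleftrightarrow>
    (\<forall>a\<in>Obj C. \<forall>b\<in>Obj C. \<forall>f\<in>Hom C a b. P a b (map_arr F f) = map_arr I f)"

definition multiplicative ::
  "('o1, 'm1) category \<Rightarrow> ('o2, 'm2) category \<Rightarrow> ('o3, 'm3) category
    \<Rightarrow> ('o1, 'm1, 'o2, 'm2) cat_functor \<Rightarrow> ('o1 \<Rightarrow> 'o1 \<Rightarrow> 'm2 \<Rightarrow> 'm3) \<Rightarrow> bool" where
  "multiplicative C D X F P \<longleftrightarrow>
    (\<forall>a\<in>Obj C. \<forall>b\<in>Obj C. \<forall>c\<in>Obj C.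
      \<forall>f\<in>Hom D (map_obj F a) (map_obj F b). \<forall>g\<in>Hom D (map_obj F b) (map_obj F c).
        P a c (g \<cdot>\<^bsub>D\<^esub> f) = P b c g \<cdot>\<^bsub>X\<^esub> P a b f)"

definition separable ::
  "('o1, 'm1) category \<Rightarrow> ('o2, 'm2) category \<Rightarrow> ('o3, 'm3) category
    \<Rightarrow> ('o1, 'm1, 'o2, 'm2) cat_functor \<Rightarrow> ('o1, 'm1, 'o3, 'm3) cat_functor \<Rightarrow> bool" where
  "separable C D X F I \<longleftrightarrow> (\<exists>P. hom_transf C D X F I P \<and> splits_arrows C F I P)"

definition heavily_separable ::
  "('o1, 'm1) category \<Rightarrow> ('o2, 'm2) category \<Rightarrow> ('o3, 'm3) category
    \<Rightarrow> ('o1, 'm1, 'o2, 'm2) cat_functor \<Rightarrow> ('o1, 'm1, 'o3, 'm3) cat_functor \<Rightarrow> bool" where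
  "heavily_separable C D X F I \<longleftrightarrow>
    (\<exists>P. hom_transf C D X F I P \<and> splits_arrows C F I P \<and> multiplicative C D X F P)"

end

theory Submission
  imports Defs
begin

text \<open>Whether a functor F is (heavily) I-separable depends only on the homs \<open>D(Fa, Fb)\<close>. For
  \<open>F\<^sup>L\<close>, and for any right adjoint with comonad L, these are the co-Kleisli homs \<open>C(La, b)\<close>, so by
  Yoneda a separating transformation is a natural \<open>\<delta> : I \<rightarrow> IL\<close> with \<open>I\<epsilon> \<circ> \<delta> = 1\<close>, multiplicative iff
  \<open>I\<Delta> \<circ> \<delta> = \<delta>L \<circ> \<delta>\<close>. Dually, on the monad side it is \<open>\<gamma> : JR \<rightarrow> J\<close> with \<open>\<gamma> \<circ> J\<iota> = 1\<close>, multiplicative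
  iff \<open>\<gamma> \<circ> J\<mu> = \<gamma> \<circ> \<gamma>R\<close>. Since \<open>LI = IL\<close> is left adjoint to \<open>JR\<close>, taking mates exchanges \<open>\<delta>\<close> and
  \<open>\<gamma>\<close>. The counit conditions correspond; the condition on \<open>\<gamma>\<close> becomes \<open>\<Delta>I \<circ> \<delta> = L\<delta> \<circ> \<delta>\<close>, so that
  \<open>L\<delta> \<circ> \<delta> = \<delta>L \<circ> \<delta>\<close> is needed. If I is full, write \<open>\<delta>\<^sub>a = I d\<close> and use naturality of \<open>\<delta>\<close> at d. If J is
  full, write \<open>\<gamma>\<^sub>b = J c\<^sub>b\<close>: then \<open>f \<circ> \<delta>\<^sub>a = c\<^sub>b \<circ> f'\<close> for every \<open>f : LIa \<rightarrow> b\<close> with transpose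
  \<open>f' : Ia \<rightarrow> Rb\<close>, and the claim
  compares this for \<open>f = L\<delta>\<^sub>a\<close> with the case \<open>f = 1\<close> at La, precomposed with \<open>\<delta>\<^sub>a\<close>.\<close>

section \<open>Rewriting rules for composition in categories, functors and natural
  transformations\<close>

context category
begin

text \<open>Typing is restated through \<open>Arr\<close>, \<open>Dom\<close> and
  \<open>Cod\<close>, so that the simplifier can compute sources and targets and discharge
  composability conditions; facts about \<open>Hom\<close> reach this form by unfolding.\<close>

lemma Arr_Comp [simp]:
  assumes "f \<in> Arr C" "g \<in> Arr C" "Dom C g = Cod C f"
  shows "g \<cdot> f \<in> Arr C" "Dom C (g \<cdot> f) = Dom C f" "Cod C (g \<cdot> f) = Cod C g"
proof -
  have "g \<cdot> f \<in> Hom C (Dom C f) (Cod C g)"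
    using assms by (intro Comp_Hom[of _ _ "Cod C f"]) (simp_all add: Hom_def)
  then show "g \<cdot> f \<in> Arr C" "Dom C (g \<cdot> f) = Dom C f" "Cod C (g \<cdot> f) = Cod C g"
    by (simp_all add: Hom_def)
qed

lemma Arr_Id [simp]:
  assumes "a \<in> Obj C"
  shows "Id C a \<in> Arr C" "Dom C (Id C a) = a" "Cod C (Id C a) = a"
  using Id_Hom[OF assms] by (auto simp: Hom_def)

lemma Comp_Id' [simp]: "f \<in> Arr C \<Longrightarrow> Dom C f = a \<Longrightarrow> f \<cdot> Id C a = f"
  and Id_Comp' [simp]: "f \<in> Arr C \<Longrightarrow> Cod C f = a \<Longrightarrow> Id C a \<cdot> f = f"
  by (auto intro: Comp_Id Id_Comp simp: Hom_def)

lemma Comp_assoc' [simp]: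
  assumes "f \<in> Arr C" "g \<in> Arr C" "h \<in> Arr C" "Dom C g = Cod C f" "Dom C h = Cod C g"
  shows "(h \<cdot> g) \<cdot> f = h \<cdot> (g \<cdot> f)"
  using assms by (intro Comp_assoc) (auto simp: Hom_def)

lemma Hom_Obj: "f \<in> Hom C a b \<Longrightarrow> a \<in> Obj C" "f \<in> Hom C a b \<Longrightarrow> b \<in> Obj C"
  using Dom_Obj Cod_Obj by (auto simp: Hom_def)

end

context cat_functor
begin

lemma Arr_map_arr [simp]:
  assumes "f \<in> Arr C"
  shows "map_arr F f \<in> Arr D"
    "Dom D (map_arr F f) = map_obj F (Dom C f)" "Cod D (map_arr F f) = map_obj F (Cod C f)"
  using map_arr_Hom[of f "Dom C f" "Cod C f"] assms by (auto simp: Hom_def)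

lemma map_arr_Comp' [simp]:
  assumes "f \<in> Arr C" "g \<in> Arr C" "Dom C g = Cod C f"
  shows "map_arr F (g \<cdot>\<^bsub>C\<^esub> f) = map_arr F g \<cdot>\<^bsub>D\<^esub> map_arr F f"
  using assms by (intro map_arr_Comp) (auto simp: Hom_def)

declare map_obj_Obj [simp] map_arr_Id [simp]

end

lemma id_functor_simps [simp]: "map_obj id_functor x = x" "map_arr id_functor f = f"
  by (auto simp: id_functor_def)

lemma comp_functor_simps [simp]:
  "map_obj (G \<odot> F) x = map_obj G (map_obj F x)" "map_arr (G \<odot> F) f = map_arr G (map_arr F f)"
  by (auto simp: comp_functor_def)

lemma cat_functor_comp:
  assumes "cat_functor C D F" "cat_functor D E G"
  shows "cat_functor C E (G \<odot> F)"
proof -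
  interpret F: cat_functor C D F by fact
  interpret G: cat_functor D E G by fact
  show ?thesis
    by unfold_locales (auto simp: Hom_def)
qed

lemma cat_functor_id: "category C \<Longrightarrow> cat_functor C C id_functor"
  by (simp add: cat_functor_def cat_functor_axioms_def)

context nat_transf
begin

lemma Arr_component [simp]:
  assumes "a \<in> Obj C"
  shows "\<alpha> a \<in> Arr D" "Dom D (\<alpha> a) = map_obj F a" "Cod D (\<alpha> a) = map_obj G a"
  using component[OF assms] by (auto simp: Hom_def)

lemma naturality':
  assumes "f \<in> Arr C" "Dom C f = a" "Cod C f = b"
  shows "\<alpha> b \<cdot>\<^bsub>D\<^esub> map_arr F f = map_arr G f \<cdot>\<^bsub>D\<^esub> \<alpha> a"
  using assms by (intro naturality) (auto simp: Hom_def)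

text \<open>Composites are normalised by bracketing to the right, where plain naturality no longer
  matches; this variant carries the remaining factor \<open>h\<close> along.\<close>

lemma naturality_Comp:
  assumes "f \<in> Arr C" "Dom C f = a" "Cod C f = b" "h \<in> Arr D" "Cod D h = map_obj F a"
  shows "\<alpha> b \<cdot>\<^bsub>D\<^esub> (map_arr F f \<cdot>\<^bsub>D\<^esub> h) = map_arr G f \<cdot>\<^bsub>D\<^esub> (\<alpha> a \<cdot>\<^bsub>D\<^esub> h)"
  using assms F.C.Dom_Obj F.C.Cod_Obj naturality'[of f a b]
  by (auto simp flip: F.D.Comp_assoc')

end

section \<open>Opposite categories\<close>

text \<open>The monad side is handled as comonad theory over \<open>op_cat C\<close>. Objects and
  arrows are kept, so the same record serves as a functor between the opposite categories.\<close>

definition op_cat :: "('o, 'm) category \<Rightarrow> ('o, 'm) category" where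
  "op_cat C = \<lparr>Obj = Obj C, Arr = Arr C, Dom = Cod C, Cod = Dom C, Id = Id C,
     Comp = (\<lambda>g f. f \<cdot>\<^bsub>C\<^esub> g)\<rparr>"

lemma op_cat_simps [simp]:
  "Obj (op_cat C) = Obj C" "Arr (op_cat C) = Arr C" "Dom (op_cat C) = Cod C"
  "Cod (op_cat C) = Dom C" "Id (op_cat C) = Id C" "g \<cdot>\<^bsub>op_cat C\<^esub> f = f \<cdot>\<^bsub>C\<^esub> g"
  by (auto simp: op_cat_def)

lemma Hom_op_cat [simp]: "Hom (op_cat C) a b = Hom C b a"
  by (auto simp: Hom_def)

lemma op_cat_op_cat [simp]: "op_cat (op_cat C) = C" for C :: "('o, 'm) category"
  by (simp add: op_cat_def)

lemma category_op_cat: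
  assumes "category C"
  shows "category (op_cat C)"
proof -
  interpret category C by fact
  show ?thesis
    by unfold_locales (auto simp: Hom_def Dom_Obj Cod_Obj)
qed

lemma cat_functor_op_cat:
  assumes "cat_functor C D F"
  shows "cat_functor (op_cat C) (op_cat D) F"
proof -
  interpret cat_functor C D F by fact
  show ?thesis
    by (intro cat_functor.intro category_op_cat C.category_axioms D.category_axioms
          cat_functor_axioms.intro) (auto simp: Hom_def)
qed

lemma nat_transf_op_cat:
  assumes "nat_transf C D F G \<alpha>"
  shows "nat_transf (op_cat C) (op_cat D) G F \<alpha>"
proof -
  interpret nat_transf C D F G \<alpha> by fact
  show ?thesis
    by (intro nat_transf.intro cat_functor_op_cat F.cat_functor_axioms G.cat_functor_axioms
          nat_transf_axioms.intro) (use component naturality in auto)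
qed

lemma functor_eq_op_cat [simp]: "functor_eq (op_cat C) F G = functor_eq C F G"
  by (simp add: functor_eq_def)

definition op_adjunction ::
  "('o1, 'm1, 'o2, 'm2) adjunction \<Rightarrow> ('o2, 'm2, 'o1, 'm1) adjunction" where
  "op_adjunction A =
    \<lparr>ladj = radj A, radj = ladj A, adj_unit = adj_counit A, adj_counit = adj_unit A\<rparr>"

lemma op_adjunction_simps [simp]:
  "ladj (op_adjunction A) = radj A" "radj (op_adjunction A) = ladj A"
  "adj_unit (op_adjunction A) = adj_counit A" "adj_counit (op_adjunction A) = adj_unit A"
  by (auto simp: op_adjunction_def)

lemma adjunction_op_cat:
  assumes "adjunction C D A"
  shows "adjunction (op_cat D) (op_cat C) (op_adjunction A)"
proof -
  interpret adjunction C D A by fact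
  show ?thesis
    by (intro adjunction.intro)
      (auto intro: cat_functor_op_cat nat_transf_op_cat ladj_functor radj_functor unit_nat
        counit_nat simp: triangle_ladj triangle_radj)
qed

text \<open>In the opposite adjunction G is the left adjoint, F the right adjoint and \<eta> the
  counit, so its comonad consists of the data GF, G\<epsilon>F, \<eta>.\<close>

lemma has_monad_op_cat:
  "has_monad C A R \<mu> \<iota> \<Longrightarrow> has_comonad (op_cat C) (op_adjunction A) R \<mu> \<iota>"
  by (simp add: has_monad_def has_comonad_def)

lemma hom_transf_op_cat:
  assumes F: "cat_functor C D F" and I: "cat_functor C X I" and P: "hom_transf C D X F I P"
  shows "hom_transf (op_cat C) (op_cat D) (op_cat X) F I (\<lambda>a b. P b a)"
proof -
  interpret F: cat_functor C D F by fact
  interpret I: cat_functor C X I by fact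
  have P_Hom: "P a b f \<in> Hom X (map_obj I a) (map_obj I b)"
    if "a \<in> Obj C" "b \<in> Obj C" "f \<in> Hom D (map_obj F a) (map_obj F b)" for a b f
    using P that by (auto simp: hom_transf_def)
  \<comment> \<open>In the opposite category the left-nested composites of \<open>hom_transf\<close>
    become right-nested ones, so associativity has to be applied on both sides.\<close>
  have "P b' a' (map_arr F u \<cdot>\<^bsub>D\<^esub> (f \<cdot>\<^bsub>D\<^esub> map_arr F v))
      = map_arr I u \<cdot>\<^bsub>X\<^esub> (P b a f \<cdot>\<^bsub>X\<^esub> map_arr I v)"
    if "a \<in> Obj C" "b \<in> Obj C" "a' \<in> Obj C" "b' \<in> Obj C" "u \<in> Hom C a a'" "v \<in> Hom C b' b"
      "f \<in> Hom D (map_obj F b) (map_obj F a)" for a b a' b' u v f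
  proof -
    have "P b' a' ((map_arr F u \<cdot>\<^bsub>D\<^esub> f) \<cdot>\<^bsub>D\<^esub> map_arr F v)
      = (map_arr I u \<cdot>\<^bsub>X\<^esub> P b a f) \<cdot>\<^bsub>X\<^esub> map_arr I v"
      using P that unfolding hom_transf_def by blast
    then show ?thesis
      using that P_Hom[of b a f] by (simp add: Hom_def)
  qed
  then show ?thesis
    using P_Hom by (auto simp: hom_transf_def)
qed

lemma splits_arrows_op_cat:
  "splits_arrows C F I P \<Longrightarrow> splits_arrows (op_cat C) F I (\<lambda>a b. P b a)"
  by (auto simp: splits_arrows_def)

lemma multiplicative_op_cat:
  "multiplicative C D X F P \<Longrightarrow>
    multiplicative (op_cat C) (op_cat D) (op_cat X) F (\<lambda>a b. P b a)"
  by (auto simp: multiplicative_def)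

text \<open>One implication suffices: \<open>op_cat\<close> is an involution, so the converse is the
  same implication for the opposite data.\<close>

lemma
  assumes F: "cat_functor C D F" and I: "cat_functor C X I"
  shows separable_op_cat:
      "separable (op_cat C) (op_cat D) (op_cat X) F I \<longleftrightarrow> separable C D X F I"
    and heavily_separable_op_cat:
      "heavily_separable (op_cat C) (op_cat D) (op_cat X) F I \<longleftrightarrow> heavily_separable C D X F I"
proof -
  note op = hom_transf_op_cat splits_arrows_op_cat multiplicative_op_cat
  have sep: "separable (op_cat C) (op_cat D) (op_cat X) F I"
    if "cat_functor C D F" "cat_functor C X I" "separable C D X F I" for C D X
    using that unfolding separable_def by (blast intro: op)
  have heavily: "heavily_separable (op_cat C) (op_cat D) (op_cat X) F I"
    if "cat_functor C D F" "cat_functor C X I" "heavily_separable C D X F I" for C D X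
    using that unfolding heavily_separable_def by (blast intro: op)
  note opF = cat_functor_op_cat[OF F] and opI = cat_functor_op_cat[OF I]
  show "separable (op_cat C) (op_cat D) (op_cat X) F I \<longleftrightarrow> separable C D X F I"
    using sep[OF F I] sep[OF opF opI] by auto
  show "heavily_separable (op_cat C) (op_cat D) (op_cat X) F I \<longleftrightarrow> heavily_separable C D X F I"
    using heavily[OF F I] heavily[OF opF opI] by auto
qed

section \<open>Separability of functors presenting a comonad\<close>

text \<open>The bijections t identify the full image of F with the co-Kleisli category of the comonad.\<close>

locale comonad_presentation = comonad C L \<Delta> \<epsilon>
  for C :: "('o, 'm) category" and L :: "('o, 'm, 'o, 'm) cat_functor" and \<Delta> \<epsilon> :: "'o \<Rightarrow> 'm" +
  fixes D :: "('o2, 'm2) category" and F :: "('o, 'm, 'o2, 'm2) cat_functor"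
    and t :: "'o \<Rightarrow> 'o \<Rightarrow> 'm2 \<Rightarrow> 'm"
  assumes F_Hom: "f \<in> Hom C a b \<Longrightarrow> map_arr F f \<in> Hom D (map_obj F a) (map_obj F b)"
    and D_Comp_Hom: "p \<in> Hom D (map_obj F a) (map_obj F b) \<Longrightarrow>
      q \<in> Hom D (map_obj F b) (map_obj F c) \<Longrightarrow> q \<cdot>\<^bsub>D\<^esub> p \<in> Hom D (map_obj F a) (map_obj F c)"
    and t_bij: "a \<in> Obj C \<Longrightarrow> b \<in> Obj C \<Longrightarrow>
      bij_betw (t a b) (Hom D (map_obj F a) (map_obj F b)) (Hom C (map_obj L a) b)"
    and t_F: "f \<in> Hom C a b \<Longrightarrow> t a b (map_arr F f) = f \<cdot>\<^bsub>C\<^esub> \<epsilon> a"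
    and t_Comp: "a \<in> Obj C \<Longrightarrow> b \<in> Obj C \<Longrightarrow> c \<in> Obj C \<Longrightarrow>
      p \<in> Hom D (map_obj F a) (map_obj F b) \<Longrightarrow> q \<in> Hom D (map_obj F b) (map_obj F c) \<Longrightarrow>
      t a c (q \<cdot>\<^bsub>D\<^esub> p) = t b c q \<cdot>\<^bsub>C\<^esub> (map_arr L (t a b p) \<cdot>\<^bsub>C\<^esub> \<Delta> a)"

text \<open>The conditions for a monad on C are obtained by taking opposite categories for C and X.\<close>

definition coaction ::
  "('o, 'm) category \<Rightarrow> ('o2, 'm2) category \<Rightarrow> ('o, 'm, 'o, 'm) cat_functor \<Rightarrow> ('o \<Rightarrow> 'm)
    \<Rightarrow> ('o, 'm, 'o2, 'm2) cat_functor \<Rightarrow> ('o \<Rightarrow> 'm2) \<Rightarrow> bool" where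
  "coaction C X L \<epsilon> I \<delta> \<longleftrightarrow> nat_transf C X I (I \<odot> L) \<delta> \<and>
     (\<forall>a\<in>Obj C. map_arr I (\<epsilon> a) \<cdot>\<^bsub>X\<^esub> \<delta> a = Id X (map_obj I a))"

definition coassociative ::
  "('o, 'm) category \<Rightarrow> ('o2, 'm2) category \<Rightarrow> ('o, 'm, 'o, 'm) cat_functor \<Rightarrow> ('o \<Rightarrow> 'm)
    \<Rightarrow> ('o, 'm, 'o2, 'm2) cat_functor \<Rightarrow> ('o \<Rightarrow> 'm2) \<Rightarrow> bool" where
  "coassociative C X L \<Delta> I \<delta> \<longleftrightarrow>
     (\<forall>a\<in>Obj C. map_arr I (\<Delta> a) \<cdot>\<^bsub>X\<^esub> \<delta> a = \<delta> (map_obj L a) \<cdot>\<^bsub>X\<^esub> \<delta> a)"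


sublocale comonad \<subseteq> L: cat_functor C C L
  using comult_nat by (rule nat_transf.axioms)

sublocale comonad \<subseteq> \<Delta>: nat_transf C C L "L \<odot> L" \<Delta>
  by (rule comult_nat)

sublocale comonad \<subseteq> \<epsilon>: nat_transf C C L id_functor \<epsilon>
  by (rule counit_nat)

context comonad_presentation
begin

lemma t_Hom:
  "a \<in> Obj C \<Longrightarrow> b \<in> Obj C \<Longrightarrow> p \<in> Hom D (map_obj F a) (map_obj F b) \<Longrightarrow>
    t a b p \<in> Hom C (map_obj L a) b"
  using bij_betwE[OF t_bij] by blast

lemma t_inj:
  "a \<in> Obj C \<Longrightarrow> b \<in> Obj C \<Longrightarrow> p \<in> Hom D (map_obj F a) (map_obj F b) \<Longrightarrow>
    q \<in> Hom D (map_obj F a) (map_obj F b) \<Longrightarrow> t a b p = t a b q \<Longrightarrow> p = q"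
  using bij_betw_imp_inj_on[OF t_bij] by (meson inj_onD)

text \<open>The co-Kleisli composite of \<open>t a b p\<close> with v\<epsilon> is v\<epsilon> after
  L(t p)\<Delta>; naturality of \<epsilon> and the left counit law remove \<epsilon> and \<Delta>.
  Precomposition, below, uses the right counit law instead.\<close>

lemma t_Comp_left:
  assumes p: "p \<in> Hom D (map_obj F a) (map_obj F b)" and v: "v \<in> Hom C b c" and a: "a \<in> Obj C"
  shows "t a c (map_arr F v \<cdot>\<^bsub>D\<^esub> p) = v \<cdot>\<^bsub>C\<^esub> t a b p"
proof -
  have b: "b \<in> Obj C" "c \<in> Obj C" using v L.C.Hom_Obj by auto
  have tp: "t a b p \<in> Hom C (map_obj L a) b" using t_Hom a b p by blast
  have "\<epsilon> b \<cdot>\<^bsub>C\<^esub> (map_arr L (t a b p) \<cdot>\<^bsub>C\<^esub> \<Delta> a) = t a b p \<cdot>\<^bsub>C\<^esub> (\<epsilon> (map_obj L a) \<cdot>\<^bsub>C\<^esub> \<Delta> a)"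
    using tp a \<epsilon>.naturality_Comp[of "t a b p" _ _ "\<Delta> a"] by (simp add: Hom_def)
  also have "\<dots> = t a b p"
    using tp a by (simp add: counit_left Hom_def)
  finally show ?thesis
    using tp a b v p F_Hom[OF v] by (simp add: t_Comp[of a b c] t_F Hom_def)
qed

lemma t_Comp_right:
  assumes p: "p \<in> Hom D (map_obj F b) (map_obj F c)" and u: "u \<in> Hom C a b" and c: "c \<in> Obj C"
  shows "t a c (p \<cdot>\<^bsub>D\<^esub> map_arr F u) = t b c p \<cdot>\<^bsub>C\<^esub> map_arr L u"
proof -
  have b: "a \<in> Obj C" "b \<in> Obj C" using u L.C.Hom_Obj by auto
  have tp: "t b c p \<in> Hom C (map_obj L b) c" using t_Hom c b p by blast
  then show ?thesis
    using b c u p F_Hom[OF u] by (simp add: t_Comp[of a b c] t_F Hom_def counit_right)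
qed

text \<open>The universal element of the functor \<open>D(Fa, F-)\<close>, which t makes isomorphic to \<open>C(La, -)\<close> on C.\<close>

definition generic :: "'o \<Rightarrow> 'm2" where
  "generic a = inv_into (Hom D (map_obj F a) (map_obj F (map_obj L a))) (t a (map_obj L a))
    (Id C (map_obj L a))"

lemma generic:
  assumes "a \<in> Obj C"
  shows "generic a \<in> Hom D (map_obj F a) (map_obj F (map_obj L a))"
    and "t a (map_obj L a) (generic a) = Id C (map_obj L a)"
proof -
  let ?H = "Hom D (map_obj F a) (map_obj F (map_obj L a))"
  have "Id C (map_obj L a) \<in> t a (map_obj L a) ` ?H"
    using bij_betw_imp_surj_on[OF t_bij] assms by (simp add: L.C.Id_Hom)
  then show "generic a \<in> ?H" "t a (map_obj L a) (generic a) = Id C (map_obj L a)"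
    unfolding generic_def by (rule inv_into_into, rule f_inv_into_f)
qed

text \<open>The Yoneda argument: both arrows have the same image under the injective map
  \<open>t a b\<close>, because the generic arrow is sent to an identity.\<close>

lemma factor_generic:
  assumes "p \<in> Hom D (map_obj F a) (map_obj F b)" "a \<in> Obj C" "b \<in> Obj C"
  shows "p = map_arr F (t a b p) \<cdot>\<^bsub>D\<^esub> generic a"
proof (rule t_inj[OF assms(2,3,1)])
  have tp: "t a b p \<in> Hom C (map_obj L a) b" using t_Hom assms by blast
  show "map_arr F (t a b p) \<cdot>\<^bsub>D\<^esub> generic a \<in> Hom D (map_obj F a) (map_obj F b)"
    using D_Comp_Hom[OF generic(1) F_Hom] tp assms by blast
  show "t a b p = t a b (map_arr F (t a b p) \<cdot>\<^bsub>D\<^esub> generic a)"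
    using tp assms by (simp add: t_Comp_left[OF generic(1)] generic(2) Hom_def)
qed

end

locale separability = comonad_presentation C L \<Delta> \<epsilon> D F t + I: cat_functor C X I
  for C :: "('o, 'm) category" and L \<Delta> \<epsilon> and D :: "('o2, 'm2) category" and F t
    and X :: "('o3, 'm3) category" and I
begin

text \<open>By \<open>factor_generic\<close>, P is determined by its values \<delta> at the generic
  arrows. Naturality of P gives naturality of \<delta>, its value at F(Id) gives the counit law, and
  multiplicativity on two consecutive generic arrows gives coassociativity.\<close>

lemma coaction_of_transf:
  assumes P: "hom_transf C D X F I P" and split: "splits_arrows C F I P"
  defines "\<delta> \<equiv> \<lambda>a. P a (map_obj L a) (generic a)"
  shows "coaction C X L \<epsilon> I \<delta>"
    and "multiplicative C D X F P \<Longrightarrow> coassociative C X L \<Delta> I \<delta>"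
proof -
  have P_Hom: "P a b p \<in> Hom X (map_obj I a) (map_obj I b)"
    if "a \<in> Obj C" "b \<in> Obj C" "p \<in> Hom D (map_obj F a) (map_obj F b)" for a b p
    using P that by (auto simp: hom_transf_def)
  \<comment> \<open>Unit laws for D are not among the axioms of a presentation; on homs between
    images of F they follow from injectivity of t.\<close>
  have FId: "p \<cdot>\<^bsub>D\<^esub> map_arr F (Id C a) = p" "map_arr F (Id C b) \<cdot>\<^bsub>D\<^esub> p = p"
    if "a \<in> Obj C" "b \<in> Obj C" "p \<in> Hom D (map_obj F a) (map_obj F b)" for a b p
    using that t_Hom[OF that]
    by (auto intro!: t_inj[OF that(1,2) _ that(3)] D_Comp_Hom[OF _ that(3)] D_Comp_Hom[OF that(3)]
        F_Hom L.C.Id_Hom simp: t_Comp_left[OF that(3) L.C.Id_Hom] t_Comp_right[OF that(3) L.C.Id_Hom])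
      (auto simp: Hom_def)
  have P_left: "P a c (map_arr F v \<cdot>\<^bsub>D\<^esub> p) = map_arr I v \<cdot>\<^bsub>X\<^esub> P a b p"
    if a: "a \<in> Obj C" and p: "p \<in> Hom D (map_obj F a) (map_obj F b)" and v: "v \<in> Hom C b c" for a b c p v
  proof -
    have b: "b \<in> Obj C" "c \<in> Obj C" using v L.C.Hom_Obj by auto
    have "P a c (map_arr F v \<cdot>\<^bsub>D\<^esub> p \<cdot>\<^bsub>D\<^esub> map_arr F (Id C a))
        = map_arr I v \<cdot>\<^bsub>X\<^esub> P a b p \<cdot>\<^bsub>X\<^esub> map_arr I (Id C a)"
      using P a b p v L.C.Id_Hom[OF a] unfolding hom_transf_def by blast
    then show ?thesis
      using FId(1)[OF a b(2) D_Comp_Hom[OF p F_Hom[OF v]]] P_Hom[OF a b(1) p] a v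
      by (simp add: Hom_def)
  qed
  have P_right: "P a c (p \<cdot>\<^bsub>D\<^esub> map_arr F u) = P b c p \<cdot>\<^bsub>X\<^esub> map_arr I u"
    if c: "c \<in> Obj C" and p: "p \<in> Hom D (map_obj F b) (map_obj F c)" and u: "u \<in> Hom C a b" for a b c p u
  proof -
    have b: "b \<in> Obj C" "a \<in> Obj C" using u L.C.Hom_Obj by auto
    have "P a c (map_arr F (Id C c) \<cdot>\<^bsub>D\<^esub> p \<cdot>\<^bsub>D\<^esub> map_arr F u)
        = map_arr I (Id C c) \<cdot>\<^bsub>X\<^esub> P b c p \<cdot>\<^bsub>X\<^esub> map_arr I u"
      using P c b p u L.C.Id_Hom[OF c] unfolding hom_transf_def by blast
    then show ?thesis
      using FId(2)[OF b(1) c p] P_Hom[OF b(1) c p] c u by (simp add: Hom_def)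
  qed
  have P_generic: "P a b p = map_arr I (t a b p) \<cdot>\<^bsub>X\<^esub> \<delta> a"
    if "a \<in> Obj C" "b \<in> Obj C" "p \<in> Hom D (map_obj F a) (map_obj F b)" for a b p
    using P_left[OF that(1) generic(1)[OF that(1)] t_Hom[OF that]] factor_generic[OF that(3,1,2)]
    by (simp add: \<delta>_def)
  have \<delta>_Hom: "\<delta> a \<in> Hom X (map_obj I a) (map_obj I (map_obj L a))" if "a \<in> Obj C" for a
    using P_Hom generic(1) that by (simp add: \<delta>_def)
  have "\<delta> b \<cdot>\<^bsub>X\<^esub> map_arr I u = map_arr I (map_arr L u) \<cdot>\<^bsub>X\<^esub> \<delta> a" if u: "u \<in> Hom C a b" for a b u
  proof -
    have b: "a \<in> Obj C" "b \<in> Obj C" using u L.C.Hom_Obj by auto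
    \<comment> \<open>This composite is also the image of the generic arrow at a under F(Lu), so
      evaluating P on it in both ways yields naturality of \<delta>.\<close>
    have "t a (map_obj L b) (generic b \<cdot>\<^bsub>D\<^esub> map_arr F u) = map_arr L u"
      using u b by (simp add: t_Comp_right[OF generic(1)] generic(2) Hom_def)
    then have "P a (map_obj L b) (generic b \<cdot>\<^bsub>D\<^esub> map_arr F u) = map_arr I (map_arr L u) \<cdot>\<^bsub>X\<^esub> \<delta> a"
      using b P_generic[OF b(1) _ D_Comp_Hom[OF F_Hom[OF u] generic(1)]] by simp
    then show ?thesis
      using P_right[OF _ generic(1) u] b by (simp add: \<delta>_def)
  qed
  moreover have "map_arr I (\<epsilon> a) \<cdot>\<^bsub>X\<^esub> \<delta> a = Id X (map_obj I a)" if a: "a \<in> Obj C" for a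
    using split P_generic[OF a a F_Hom[OF L.C.Id_Hom[OF a]]] a L.C.Id_Hom[OF a]
    by (simp add: splits_arrows_def t_F[OF L.C.Id_Hom[OF a]])
  ultimately show "coaction C X L \<epsilon> I \<delta>"
    using \<delta>_Hom cat_functor_comp[OF L.cat_functor_axioms I.cat_functor_axioms]
    by (auto simp: coaction_def nat_transf_def nat_transf_axioms_def I.cat_functor_axioms)
  assume mult: "multiplicative C D X F P"
  show "coassociative C X L \<Delta> I \<delta>"
    unfolding coassociative_def
  proof
    fix a assume a: "a \<in> Obj C"
    let ?a1 = "map_obj L a" and ?a2 = "map_obj L (map_obj L a)"
    have k: "generic a \<in> Hom D (map_obj F a) (map_obj F ?a1)"
      "generic ?a1 \<in> Hom D (map_obj F ?a1) (map_obj F ?a2)"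
      using a generic(1) by auto
    \<comment> \<open>Both generic arrows correspond to identities, and the co-Kleisli composite of
      these identities is \<Delta>.\<close>
    have "t a ?a2 (generic ?a1 \<cdot>\<^bsub>D\<^esub> generic a) = \<Delta> a"
      using a by (simp add: t_Comp[OF _ _ _ k] generic(2))
    then have "P a ?a2 (generic ?a1 \<cdot>\<^bsub>D\<^esub> generic a) = map_arr I (\<Delta> a) \<cdot>\<^bsub>X\<^esub> \<delta> a"
      using P_generic[OF a _ D_Comp_Hom[OF k]] a by simp
    moreover have "P a ?a2 (generic ?a1 \<cdot>\<^bsub>D\<^esub> generic a) = \<delta> ?a1 \<cdot>\<^bsub>X\<^esub> \<delta> a"
      using mult a k unfolding multiplicative_def \<delta>_def by simp
    ultimately show "map_arr I (\<Delta> a) \<cdot>\<^bsub>X\<^esub> \<delta> a = \<delta> ?a1 \<cdot>\<^bsub>X\<^esub> \<delta> a" by simp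
  qed
qed

text \<open>The formula for P is the one forced by the Yoneda argument. For multiplicativity,
  naturality of \<delta> at \<open>t a b p\<close> moves the inner \<delta> to the right, where
  \<delta>L after \<delta> is replaced by I\<Delta> after \<delta>.\<close>

lemma transf_of_coaction:
  assumes \<delta>: "coaction C X L \<epsilon> I \<delta>"
  defines "P \<equiv> \<lambda>a b p. map_arr I (t a b p) \<cdot>\<^bsub>X\<^esub> \<delta> a"
  shows "hom_transf C D X F I P" and "splits_arrows C F I P"
    and "coassociative C X L \<Delta> I \<delta> \<Longrightarrow> multiplicative C D X F P"
proof -
  interpret \<delta>: nat_transf C X I "I \<odot> L" \<delta> using \<delta> by (simp add: coaction_def)
  have counit: "map_arr I (\<epsilon> a) \<cdot>\<^bsub>X\<^esub> \<delta> a = Id X (map_obj I a)" if "a \<in> Obj C" for a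
    using \<delta> that by (simp add: coaction_def)
  have "P a b p \<in> Hom X (map_obj I a) (map_obj I b)"
    if "a \<in> Obj C" "b \<in> Obj C" "p \<in> Hom D (map_obj F a) (map_obj F b)" for a b p
    using t_Hom[OF that] that by (simp add: P_def Hom_def)
  moreover have "P a' b' (map_arr F v \<cdot>\<^bsub>D\<^esub> p \<cdot>\<^bsub>D\<^esub> map_arr F u)
      = map_arr I v \<cdot>\<^bsub>X\<^esub> P a b p \<cdot>\<^bsub>X\<^esub> map_arr I u"
    if "a \<in> Obj C" "b \<in> Obj C" "a' \<in> Obj C" "b' \<in> Obj C" and u: "u \<in> Hom C a' a"
      and v: "v \<in> Hom C b b'" and p: "p \<in> Hom D (map_obj F a) (map_obj F b)" for a b a' b' u v p
  proof -
    have "t a' b' (map_arr F v \<cdot>\<^bsub>D\<^esub> p \<cdot>\<^bsub>D\<^esub> map_arr F u) = v \<cdot>\<^bsub>C\<^esub> t a b p \<cdot>\<^bsub>C\<^esub> map_arr L u"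
      using that D_Comp_Hom[OF p F_Hom[OF v]] by (simp add: t_Comp_right t_Comp_left[OF p v])
    then show ?thesis
      using that t_Hom[OF _ _ p] \<delta>.naturality[OF u] by (simp add: P_def Hom_def)
  qed
  ultimately show "hom_transf C D X F I P"
    by (simp add: hom_transf_def)
  show "splits_arrows C F I P"
    by (auto simp: splits_arrows_def P_def t_F counit Hom_def)
  assume coassoc: "coassociative C X L \<Delta> I \<delta>"
  have "P a c (q \<cdot>\<^bsub>D\<^esub> p) = P b c q \<cdot>\<^bsub>X\<^esub> P a b p"
    if o: "a \<in> Obj C" "b \<in> Obj C" "c \<in> Obj C" and p: "p \<in> Hom D (map_obj F a) (map_obj F b)"
      and q: "q \<in> Hom D (map_obj F b) (map_obj F c)" for a b c p q
  proof -
    note h = t_Hom[OF o(1,2) p] t_Hom[OF o(2,3) q]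
    have "map_arr I (\<Delta> a) \<cdot>\<^bsub>X\<^esub> \<delta> a = \<delta> (map_obj L a) \<cdot>\<^bsub>X\<^esub> \<delta> a"
      using coassoc o by (simp add: coassociative_def)
    then show ?thesis
      using h o \<delta>.naturality_Comp[of "t a b p" "map_obj L a" b "\<delta> a"]
      by (simp add: P_def t_Comp[OF o p q] Hom_def)
  qed
  then show "multiplicative C D X F P"
    by (simp add: multiplicative_def)
qed

theorem separable_iff: "separable C D X F I \<longleftrightarrow> (\<exists>\<delta>. coaction C X L \<epsilon> I \<delta>)"
  unfolding separable_def using coaction_of_transf transf_of_coaction by blast

theorem heavily_separable_iff:
  "heavily_separable C D X F I \<longleftrightarrow> (\<exists>\<delta>. coaction C X L \<epsilon> I \<delta> \<and> coassociative C X L \<Delta> I \<delta>)"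
  unfolding heavily_separable_def using coaction_of_transf transf_of_coaction by blast

end


section \<open>Transposition along an adjunction\<close>

sublocale adjunction \<subseteq> ladj: cat_functor C D "ladj A"
  by (rule ladj_functor)

sublocale adjunction \<subseteq> radj: cat_functor D C "radj A"
  by (rule radj_functor)

sublocale adjunction \<subseteq> unit: nat_transf C C id_functor "radj A \<odot> ladj A" "adj_unit A"
  by (rule unit_nat)

sublocale adjunction \<subseteq> counit: nat_transf D D "ladj A \<odot> radj A" id_functor "adj_counit A"
  by (rule counit_nat)

context adjunction
begin

definition transpose where
  "transpose a f = map_arr (radj A) f \<cdot>\<^bsub>C\<^esub> adj_unit A a"

definition untranspose where
  "untranspose b g = adj_counit A b \<cdot>\<^bsub>D\<^esub> map_arr (ladj A) g"

lemma transpose_Hom: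
  "a \<in> Obj C \<Longrightarrow> f \<in> Hom D (map_obj (ladj A) a) b \<Longrightarrow> transpose a f \<in> Hom C a (map_obj (radj A) b)"
  by (simp add: transpose_def Hom_def)

lemma untranspose_Hom:
  "b \<in> Obj D \<Longrightarrow> g \<in> Hom C a (map_obj (radj A) b) \<Longrightarrow> untranspose b g \<in> Hom D (map_obj (ladj A) a) b"
  by (simp add: untranspose_def Hom_def)

lemma transpose_postcomp:
  assumes "f \<in> Hom D (map_obj (ladj A) a) b" "v \<in> Hom D b c" "a \<in> Obj C"
  shows "map_arr (radj A) v \<cdot>\<^bsub>C\<^esub> transpose a f = transpose a (v \<cdot>\<^bsub>D\<^esub> f)"
  using assms by (simp add: transpose_def Hom_def)

lemma transpose_precomp:
  assumes "f \<in> Hom D (map_obj (ladj A) a) b" "u \<in> Hom C a' a"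
  shows "transpose a f \<cdot>\<^bsub>C\<^esub> u = transpose a' (f \<cdot>\<^bsub>D\<^esub> map_arr (ladj A) u)"
  using assms unit.naturality'[of u a' a] ladj.C.Hom_Obj[OF assms(2)]
  by (simp add: transpose_def Hom_def)

lemma untranspose_transpose [simp]:
  assumes "f \<in> Hom D (map_obj (ladj A) a) b" "a \<in> Obj C"
  shows "untranspose b (transpose a f) = f"
  using assms counit.naturality_Comp[of f "map_obj (ladj A) a" b "map_arr (ladj A) (adj_unit A a)"]
    ladj.D.Hom_Obj[OF assms(1)]
  by (simp add: transpose_def untranspose_def Hom_def triangle_ladj)

lemma transpose_untranspose [simp]:
  assumes "g \<in> Hom C a (map_obj (radj A) b)" "b \<in> Obj D"
  shows "transpose a (untranspose b g) = g"
proof -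
  have "map_arr (radj A) (map_arr (ladj A) g) \<cdot>\<^bsub>C\<^esub> adj_unit A a = adj_unit A (map_obj (radj A) b) \<cdot>\<^bsub>C\<^esub> g"
    using assms unit.naturality'[of g a "map_obj (radj A) b"] by (simp add: Hom_def)
  then have "transpose a (untranspose b g)
      = (map_arr (radj A) (adj_counit A b) \<cdot>\<^bsub>C\<^esub> adj_unit A (map_obj (radj A) b)) \<cdot>\<^bsub>C\<^esub> g"
    using assms ladj.C.Hom_Obj[OF assms(1)]
    by (simp add: transpose_def untranspose_def Hom_def)
  then show ?thesis
    using assms by (simp add: triangle_radj Hom_def)
qed

lemma bij_untranspose:
  assumes "a \<in> Obj C" "b \<in> Obj D"
  shows "bij_betw (untranspose b) (Hom C a (map_obj (radj A) b)) (Hom D (map_obj (ladj A) a) b)"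
  by (rule bij_betw_byWitness[where f' = "transpose a"])
    (use assms in \<open>auto intro: transpose_Hom untranspose_Hom\<close>)

lemma transpose_inj:
  "transpose a f = transpose a g \<Longrightarrow> f \<in> Hom D (map_obj (ladj A) a) b \<Longrightarrow>
    g \<in> Hom D (map_obj (ladj A) a) b \<Longrightarrow> a \<in> Obj C \<Longrightarrow> f = g"
  by (metis untranspose_transpose)

end

section \<open>Presentations of a comonad by its cofree functor and by right adjoints\<close>

context comonad
begin

text \<open>Here \<open>w\<close> identifies the homs of D with coalgebra morphisms between cofree
  coalgebras. Such a morphism is determined by its composite with \<epsilon>, by the universal
  property of cofree coalgebras.\<close>

lemma comonad_presentation_of_coalg_hom:
  fixes D :: "('o2, 'm2) category"
  assumes F: "\<And>f a b. f \<in> Hom C a b \<Longrightarrow> map_arr F f \<in> Hom D (map_obj F a) (map_obj F b)"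
    and comp: "\<And>p q a b c. p \<in> Hom D (map_obj F a) (map_obj F b) \<Longrightarrow>
      q \<in> Hom D (map_obj F b) (map_obj F c) \<Longrightarrow> q \<cdot>\<^bsub>D\<^esub> p \<in> Hom D (map_obj F a) (map_obj F c)"
    and bij: "\<And>a b. a \<in> Obj C \<Longrightarrow> b \<in> Obj C \<Longrightarrow> bij_betw w (Hom D (map_obj F a) (map_obj F b))
      {f \<in> Hom C (map_obj L a) (map_obj L b). \<Delta> b \<cdot>\<^bsub>C\<^esub> f = map_arr L f \<cdot>\<^bsub>C\<^esub> \<Delta> a}"
    and w_F: "\<And>f. f \<in> Arr C \<Longrightarrow> w (map_arr F f) = map_arr L f"
    and w_comp: "\<And>p q a b c. p \<in> Hom D (map_obj F a) (map_obj F b) \<Longrightarrow>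
      q \<in> Hom D (map_obj F b) (map_obj F c) \<Longrightarrow> w (q \<cdot>\<^bsub>D\<^esub> p) = w q \<cdot>\<^bsub>C\<^esub> w p"
  shows "comonad_presentation C L \<Delta> \<epsilon> D F (\<lambda>a b p. \<epsilon> b \<cdot>\<^bsub>C\<^esub> w p)"
proof -
  have w: "w p \<in> Hom C (map_obj L a) (map_obj L b)" "\<Delta> b \<cdot>\<^bsub>C\<^esub> w p = map_arr L (w p) \<cdot>\<^bsub>C\<^esub> \<Delta> a"
    if "a \<in> Obj C" "b \<in> Obj C" "p \<in> Hom D (map_obj F a) (map_obj F b)" for a b p
    using bij_betwE[OF bij] that by blast+
  have right: "map_arr L (\<epsilon> b) \<cdot>\<^bsub>C\<^esub> (\<Delta> b \<cdot>\<^bsub>C\<^esub> f) = f" if "b \<in> Obj C" "f \<in> Hom C a (map_obj L b)" for a b f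
    using that by (simp add: counit_right Hom_def flip: L.C.Comp_assoc')
  show ?thesis
  proof
    fix a b assume ab: "a \<in> Obj C" "b \<in> Obj C"
    have "bij_betw (\<lambda>f. \<epsilon> b \<cdot>\<^bsub>C\<^esub> f)
      {f \<in> Hom C (map_obj L a) (map_obj L b). \<Delta> b \<cdot>\<^bsub>C\<^esub> f = map_arr L f \<cdot>\<^bsub>C\<^esub> \<Delta> a} (Hom C (map_obj L a) b)"
    \<comment> \<open>The inverse sends g to its coextension Lg after \<Delta>, which is a coalgebra
      morphism by naturality of \<Delta> and coassociativity.\<close>
    proof (rule bij_betw_byWitness[where f' = "\<lambda>g. map_arr L g \<cdot>\<^bsub>C\<^esub> \<Delta> a"])
      show "\<forall>f\<in>{f \<in> Hom C (map_obj L a) (map_obj L b). \<Delta> b \<cdot>\<^bsub>C\<^esub> f = map_arr L f \<cdot>\<^bsub>C\<^esub> \<Delta> a}.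
          map_arr L (\<epsilon> b \<cdot>\<^bsub>C\<^esub> f) \<cdot>\<^bsub>C\<^esub> \<Delta> a = f"
      proof clarify
        fix f assume f: "f \<in> Hom C (map_obj L a) (map_obj L b)"
          and eq: "\<Delta> b \<cdot>\<^bsub>C\<^esub> f = map_arr L f \<cdot>\<^bsub>C\<^esub> \<Delta> a"
        show "map_arr L (\<epsilon> b \<cdot>\<^bsub>C\<^esub> f) \<cdot>\<^bsub>C\<^esub> \<Delta> a = f"
          using f ab right[OF ab(2) f] by (simp add: Hom_def flip: eq)
      qed
      show "\<forall>g\<in>Hom C (map_obj L a) b. \<epsilon> b \<cdot>\<^bsub>C\<^esub> (map_arr L g \<cdot>\<^bsub>C\<^esub> \<Delta> a) = g"
        using \<epsilon>.naturality_Comp[of _ "map_obj L a" b "\<Delta> a"] ab by (auto simp: counit_left Hom_def)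
      show "(\<cdot>\<^bsub>C\<^esub>) (\<epsilon> b) ` {f \<in> Hom C (map_obj L a) (map_obj L b). \<Delta> b \<cdot>\<^bsub>C\<^esub> f = map_arr L f \<cdot>\<^bsub>C\<^esub> \<Delta> a}
          \<subseteq> Hom C (map_obj L a) b"
        using ab by (auto simp: Hom_def)
      show "(\<lambda>g. map_arr L g \<cdot>\<^bsub>C\<^esub> \<Delta> a) ` Hom C (map_obj L a) b
          \<subseteq> {f \<in> Hom C (map_obj L a) (map_obj L b). \<Delta> b \<cdot>\<^bsub>C\<^esub> f = map_arr L f \<cdot>\<^bsub>C\<^esub> \<Delta> a}"
        using ab \<Delta>.naturality_Comp[of _ "map_obj L a" b "\<Delta> a"]
        by (auto simp: Hom_def coassoc)
    qed
    from bij_betw_trans[OF bij[OF ab] this]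
    show "bij_betw (\<lambda>p. \<epsilon> b \<cdot>\<^bsub>C\<^esub> w p) (Hom D (map_obj F a) (map_obj F b)) (Hom C (map_obj L a) b)"
      by (simp add: comp_def)
  next
    fix f a b assume "f \<in> Hom C a b"
    then show "\<epsilon> b \<cdot>\<^bsub>C\<^esub> w (map_arr F f) = f \<cdot>\<^bsub>C\<^esub> \<epsilon> a"
      using \<epsilon>.naturality'[of f a b] by (simp add: w_F Hom_def)
  next
    fix a b c p q
    assume abc: "a \<in> Obj C" "b \<in> Obj C" "c \<in> Obj C"
      and pq: "p \<in> Hom D (map_obj F a) (map_obj F b)" "q \<in> Hom D (map_obj F b) (map_obj F c)"
    note h = w[OF abc(1,2) pq(1)] w[OF abc(2,3) pq(2)]
    \<comment> \<open>The morphism \<open>w p\<close> is the coextension of its own composite with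
      \<epsilon>, so co-Kleisli composition becomes composition of the values of
      \<open>w\<close>.\<close>
    have "map_arr L (\<epsilon> b) \<cdot>\<^bsub>C\<^esub> (map_arr L (w p) \<cdot>\<^bsub>C\<^esub> \<Delta> a) = w p"
      using right[OF abc(2) h(1)] h(2) by simp
    then show "\<epsilon> c \<cdot>\<^bsub>C\<^esub> w (q \<cdot>\<^bsub>D\<^esub> p)
        = \<epsilon> c \<cdot>\<^bsub>C\<^esub> w q \<cdot>\<^bsub>C\<^esub> (map_arr L (\<epsilon> b \<cdot>\<^bsub>C\<^esub> w p) \<cdot>\<^bsub>C\<^esub> \<Delta> a)"
      using h(1,3) abc by (simp add: w_comp[OF pq] Hom_def)
  qed (use F comp in blast)+
qed

lemma Hom_EM_coalg:
  "p \<in> Hom (EM_coalg C L \<Delta> \<epsilon>) s u \<longleftrightarrow> s \<in> Obj (EM_coalg C L \<Delta> \<epsilon>) \<and> u \<in> Obj (EM_coalg C L \<Delta> \<epsilon>) \<and>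
    (\<exists>f\<in>Hom C (fst s) (fst u). p = (s, f, u) \<and> snd u \<cdot>\<^bsub>C\<^esub> f = map_arr L f \<cdot>\<^bsub>C\<^esub> snd s)"
  by (cases s; cases u) (auto simp: EM_coalg_def Let_def Hom_def)

lemma Obj_EM_coalg:
  "s \<in> Obj (EM_coalg C L \<Delta> \<epsilon>) \<Longrightarrow> fst s \<in> Obj C \<and> snd s \<in> Hom C (fst s) (map_obj L (fst s))"
  by (auto simp: EM_coalg_def Let_def)

lemma Comp_EM_coalg [simp]: "(t, g, u) \<cdot>\<^bsub>EM_coalg C L \<Delta> \<epsilon>\<^esub> (s, f, t') = (s, g \<cdot>\<^bsub>C\<^esub> f, u)"
  by (simp add: EM_coalg_def Let_def)

lemma category_EM_coalg: "category (EM_coalg C L \<Delta> \<epsilon>)"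
proof
  fix p assume p: "p \<in> Arr (EM_coalg C L \<Delta> \<epsilon>)"
  then show "Dom (EM_coalg C L \<Delta> \<epsilon>) p \<in> Obj (EM_coalg C L \<Delta> \<epsilon>)" "Cod (EM_coalg C L \<Delta> \<epsilon>) p \<in> Obj (EM_coalg C L \<Delta> \<epsilon>)"
    by (auto simp: EM_coalg_def Let_def)
next
  fix s assume "s \<in> Obj (EM_coalg C L \<Delta> \<epsilon>)"
  with Obj_EM_coalg[OF this] show "Id (EM_coalg C L \<Delta> \<epsilon>) s \<in> Hom (EM_coalg C L \<Delta> \<epsilon>) s s"
    by (auto simp: Hom_EM_coalg) (auto simp: EM_coalg_def Let_def Hom_def)
next
  fix p q s u r
  assume p: "p \<in> Hom (EM_coalg C L \<Delta> \<epsilon>) s u" and q: "q \<in> Hom (EM_coalg C L \<Delta> \<epsilon>) u r"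
  then obtain f g where fg: "f \<in> Hom C (fst s) (fst u)" "g \<in> Hom C (fst u) (fst r)"
    "snd u \<cdot>\<^bsub>C\<^esub> f = map_arr L f \<cdot>\<^bsub>C\<^esub> snd s" "snd r \<cdot>\<^bsub>C\<^esub> g = map_arr L g \<cdot>\<^bsub>C\<^esub> snd u"
    and pq: "p = (s, f, u)" "q = (u, g, r)"
    by (auto simp: Hom_EM_coalg)
  have Ob: "s \<in> Obj (EM_coalg C L \<Delta> \<epsilon>)" "u \<in> Obj (EM_coalg C L \<Delta> \<epsilon>)" "r \<in> Obj (EM_coalg C L \<Delta> \<epsilon>)"
    using p q by (auto simp: Hom_EM_coalg)
  note h = Ob[THEN Obj_EM_coalg, THEN conjunct2]
  have "snd r \<cdot>\<^bsub>C\<^esub> (g \<cdot>\<^bsub>C\<^esub> f) = (snd r \<cdot>\<^bsub>C\<^esub> g) \<cdot>\<^bsub>C\<^esub> f"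
    using fg(1,2) h by (simp add: Hom_def)
  also have "\<dots> = map_arr L (g \<cdot>\<^bsub>C\<^esub> f) \<cdot>\<^bsub>C\<^esub> snd s"
    using fg(1,2) h by (simp add: fg(3,4) Hom_def)
  finally show "q \<cdot>\<^bsub>EM_coalg C L \<Delta> \<epsilon>\<^esub> p \<in> Hom (EM_coalg C L \<Delta> \<epsilon>) s r"
    using Ob fg(1,2) pq L.C.Comp_Hom by (auto simp: Hom_EM_coalg)
qed (auto simp: Hom_EM_coalg, auto simp: EM_coalg_def Let_def Hom_def)

lemma cofree_coalg_Obj:
  "a \<in> Obj C \<Longrightarrow> map_obj (cofree_coalg L \<Delta> C) a \<in> Obj (EM_coalg C L \<Delta> \<epsilon>)"
  by (simp add: EM_coalg_def cofree_coalg_def Let_def Hom_def counit_left coassoc)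

lemma cofree_coalg_simps [simp]:
  "map_obj (cofree_coalg L \<Delta> C) a = (map_obj L a, \<Delta> a)"
  "f \<in> Hom C a b \<Longrightarrow>
    map_arr (cofree_coalg L \<Delta> C) f = ((map_obj L a, \<Delta> a), map_arr L f, (map_obj L b, \<Delta> b))"
  by (auto simp: cofree_coalg_def Hom_def)

text \<open>The role of \<open>w\<close> is played by the middle entry of a triple; the outer
  entries are fixed by a and b, so nothing is lost.\<close>

lemma comonad_presentation_EM_coalg:
  "comonad_presentation C L \<Delta> \<epsilon> (EM_coalg C L \<Delta> \<epsilon>) (cofree_coalg L \<Delta> C)
    (\<lambda>a b p. \<epsilon> b \<cdot>\<^bsub>C\<^esub> fst (snd p))"
proof (rule comonad_presentation_of_coalg_hom, goal_cases)
  case (1 f a b)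
  then show ?case
    using cofree_coalg_Obj[of a] cofree_coalg_Obj[of b] L.C.Hom_Obj[OF 1] \<Delta>.naturality[OF 1]
      L.map_arr_Hom[OF 1]
    by (auto simp: Hom_EM_coalg)
next
  case (2 p q a b c)
  then show ?case by (rule category.Comp_Hom[OF category_EM_coalg])
next
  case (3 a b)
  show ?case
    by (rule bij_betw_byWitness[where f' = "\<lambda>f. ((map_obj L a, \<Delta> a), f, (map_obj L b, \<Delta> b))"])
      (use cofree_coalg_Obj[OF 3(1)] cofree_coalg_Obj[OF 3(2)] in \<open>auto simp: Hom_EM_coalg\<close>)
next
  case (4 f)
  then show ?case by (simp add: cofree_coalg_def)
next
  case (5 p q a b c)
  then show ?case by (auto simp: Hom_EM_coalg)
qed

text \<open>For a right adjoint Q with left adjoint P', the homs B(Qa, Qb) are already C(P'Qa, b) =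
  C(La, b), so the adjunction bijection itself serves as t and no comparison functor is
  involved.\<close>

lemma comonad_presentation_adjunction:
  fixes B :: "('b, 'bm) category"
  assumes "adjunction B C A" and A: "has_comonad C A L \<Delta> \<epsilon>"
  shows "comonad_presentation C L \<Delta> \<epsilon> B (radj A) (\<lambda>a b. adjunction.untranspose C A b)"
proof -
  interpret A: adjunction B C A by fact
  have L_obj: "map_obj (ladj A) (map_obj (radj A) a) = map_obj L a" if "a \<in> Obj C" for a
    using A that by (simp add: has_comonad_def functor_eq_def)
  have L_arr: "map_arr (ladj A) (map_arr (radj A) f) = map_arr L f" if "f \<in> Arr C" for f
    using A that by (simp add: has_comonad_def functor_eq_def)
  have \<Delta>: "map_arr (ladj A) (adj_unit A (map_obj (radj A) a)) = \<Delta> a" if "a \<in> Obj C" for a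
    using A that by (simp add: has_comonad_def)
  have \<epsilon>: "adj_counit A a = \<epsilon> a" if "a \<in> Obj C" for a
    using A that by (simp add: has_comonad_def)
  show ?thesis
  proof
    fix a b assume ab: "a \<in> Obj C" "b \<in> Obj C"
    then show "bij_betw (A.untranspose b) (Hom B (map_obj (radj A) a) (map_obj (radj A) b))
        (Hom C (map_obj L a) b)"
      using A.bij_untranspose[of "map_obj (radj A) a" b] by (simp add: L_obj)
  next
    fix f a b assume f: "f \<in> Hom C a b"
    then show "A.untranspose b (map_arr (radj A) f) = f \<cdot>\<^bsub>C\<^esub> \<epsilon> a"
      using A.counit.naturality'[of f a b] L.C.Hom_Obj[OF f]
      by (simp add: A.untranspose_def \<epsilon> Hom_def)
  next
    fix a b c p q
    assume abc: "a \<in> Obj C" "b \<in> Obj C" "c \<in> Obj C"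
      and pq: "p \<in> Hom B (map_obj (radj A) a) (map_obj (radj A) b)"
        "q \<in> Hom B (map_obj (radj A) b) (map_obj (radj A) c)"
    note h = A.untranspose_Hom[OF abc(2) pq(1)]
    \<comment> \<open>Writing p as the transpose of its untranspose exposes the unit, whose image
      under the left adjoint is \<Delta>.\<close>
    have "map_arr (ladj A) p = map_arr (ladj A) (A.transpose (map_obj (radj A) a) (A.untranspose b p))"
      using pq abc by simp
    also have "\<dots> = map_arr L (A.untranspose b p) \<cdot>\<^bsub>C\<^esub> \<Delta> a"
      using h abc by (simp add: A.transpose_def Hom_def L_arr \<Delta>)
    finally show "A.untranspose c (q \<cdot>\<^bsub>B\<^esub> p)
        = A.untranspose c q \<cdot>\<^bsub>C\<^esub> (map_arr L (A.untranspose b p) \<cdot>\<^bsub>C\<^esub> \<Delta> a)"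
      using pq abc by (simp add: A.untranspose_def Hom_def L_obj)
  qed (use A.radj.map_arr_Hom A.ladj.C.Comp_Hom in blast)+
qed

end

text \<open>\<open>\<sigma>\<close> will interchange the source and the target entry of an arrow of an
  Eilenberg-Moore category; this identifies the opposite of \<^const>\<open>EM_alg\<close> with \<^const>\<open>EM_coalg\<close>
  over the opposite category.\<close>

locale arrow_relabelling =
  fixes D D' :: "('o, 'm) category" and \<sigma> :: "'m \<Rightarrow> 'm"
  assumes \<sigma>_\<sigma> [simp]: "\<sigma> (\<sigma> p) = p"
    and Obj' [simp]: "Obj D' = Obj D"
    and Arr' [simp]: "p \<in> Arr D' \<longleftrightarrow> \<sigma> p \<in> Arr D"
    and Dom' [simp]: "Dom D' p = Dom D (\<sigma> p)"
    and Cod' [simp]: "Cod D' p = Cod D (\<sigma> p)"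
    and Id' [simp]: "Id D' a = \<sigma> (Id D a)"
    and Comp' [simp]: "q \<cdot>\<^bsub>D'\<^esub> p = \<sigma> (\<sigma> q \<cdot>\<^bsub>D\<^esub> \<sigma> p)"
begin

lemma Hom': "p \<in> Hom D' a b \<longleftrightarrow> \<sigma> p \<in> Hom D a b"
  by (simp add: Hom_def)

lemma category_relabelled:
  assumes "category D"
  shows "category D'"
proof -
  interpret category D by fact
  show ?thesis
  proof
    show "g \<cdot>\<^bsub>D'\<^esub> f \<in> Hom D' a c" if "f \<in> Hom D' a b" "g \<in> Hom D' b c" for f g a b c
      using that Comp_Hom by (auto simp: Hom')
  qed (simp_all add: Hom_def Dom_Obj Cod_Obj)
qed

lemma presentation_relabelled:
  assumes "comonad_presentation C L \<Delta> \<epsilon> D F t"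
    and obj: "map_obj F' = map_obj F"
    and arr: "\<And>f. f \<in> Arr C \<Longrightarrow> map_arr F' f = \<sigma> (map_arr F f)"
  shows "comonad_presentation C L \<Delta> \<epsilon> D' F' (\<lambda>a b p. t a b (\<sigma> p))"
proof -
  interpret comonad_presentation C L \<Delta> \<epsilon> D F t by fact
  show ?thesis
  proof
    fix a b assume "a \<in> Obj C" "b \<in> Obj C"
    moreover have "bij_betw \<sigma> (Hom D' (map_obj F a) (map_obj F b)) (Hom D (map_obj F a) (map_obj F b))"
      by (rule bij_betw_byWitness[where f' = \<sigma>]) (auto simp: Hom')
    ultimately show "bij_betw (\<lambda>p. t a b (\<sigma> p)) (Hom D' (map_obj F' a) (map_obj F' b)) (Hom C (map_obj L a) b)"
      using bij_betw_trans[OF _ t_bij] by (fastforce simp: comp_def obj)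
  next
    fix f a b assume "f \<in> Hom C a b"
    then show "map_arr F' f \<in> Hom D' (map_obj F' a) (map_obj F' b)" "t a b (\<sigma> (map_arr F' f)) = f \<cdot>\<^bsub>C\<^esub> \<epsilon> a"
      using arr[of f] F_Hom t_F by (auto simp: Hom' obj Hom_def[of C])
  qed (use D_Comp_Hom t_Comp in \<open>auto simp: Hom' obj\<close>)
qed

end

lemma arrow_relabelling_EM_alg:
  "arrow_relabelling (EM_coalg (op_cat C) R \<mu> \<iota>) (op_cat (EM_alg C R \<mu> \<iota>)) (\<lambda>(s, f, u). (u, f, s))"
  by unfold_locales (auto simp: EM_coalg_def EM_alg_def Let_def split: prod.splits)

section \<open>Algebras of a monad, obtained from coalgebras over the opposite category\<close>

context
  fixes C :: "('o, 'm) category" and R \<mu> \<iota>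
  assumes monad: "comonad (op_cat C) R \<mu> \<iota>" and C: "category C"
begin

lemma category_EM_alg: "category (EM_alg C R \<mu> \<iota>)"
  using category_op_cat[OF arrow_relabelling.category_relabelled[OF arrow_relabelling_EM_alg
        comonad.category_EM_coalg[OF monad]]]
  by simp

lemma comonad_presentation_EM_alg:
  "comonad_presentation (op_cat C) R \<mu> \<iota> (op_cat (EM_alg C R \<mu> \<iota>)) (free_alg R \<mu> C)
    (\<lambda>a b p. \<iota> b \<cdot>\<^bsub>op_cat C\<^esub> fst (snd (case p of (s, f, u) \<Rightarrow> (u, f, s))))"
  by (rule arrow_relabelling.presentation_relabelled[OF arrow_relabelling_EM_alg
        comonad.comonad_presentation_EM_coalg[OF monad]])
    (auto simp: free_alg_def cofree_coalg_def)

text \<open>Passing between a functor and its opposite in \<open>separable_op_cat\<close> requires a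
  genuine functor, which is more than a presentation asserts.\<close>

lemma cat_functor_free_alg: "cat_functor C (EM_alg C R \<mu> \<iota>) (free_alg R \<mu> C)"
proof -
  interpret C: category C by (rule C)
  interpret E: category "EM_alg C R \<mu> \<iota>" by (rule category_EM_alg)
  interpret P: comonad_presentation "op_cat C" R \<mu> \<iota> "op_cat (EM_alg C R \<mu> \<iota>)" "free_alg R \<mu> C"
    "\<lambda>a b p. \<iota> b \<cdot>\<^bsub>op_cat C\<^esub> fst (snd (case p of (s, f, u) \<Rightarrow> (u, f, s)))"
    by (rule comonad_presentation_EM_alg)
  have Hom: "map_arr (free_alg R \<mu> C) f \<in>
      Hom (EM_alg C R \<mu> \<iota>) (map_obj (free_alg R \<mu> C) a) (map_obj (free_alg R \<mu> C) b)"
    if "f \<in> Hom C a b" for f a b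
    using P.F_Hom[of f b a] that by simp
  show ?thesis
  proof
    \<comment> \<open>The object is recognised as the source of the image of an identity
      arrow.\<close>
    show "map_obj (free_alg R \<mu> C) a \<in> Obj (EM_alg C R \<mu> \<iota>)" if "a \<in> Obj C" for a
      using E.Hom_Obj(1)[OF Hom[OF C.Id_Hom[OF that]]] .
    show "map_arr (free_alg R \<mu> C) (Id C a) = Id (EM_alg C R \<mu> \<iota>) (map_obj (free_alg R \<mu> C) a)"
      if "a \<in> Obj C" for a
      using that P.L.map_arr_Id[of a] by (simp add: free_alg_def EM_alg_def Let_def)
    show "map_arr (free_alg R \<mu> C) (g \<cdot>\<^bsub>C\<^esub> f)
      = map_arr (free_alg R \<mu> C) g \<cdot>\<^bsub>EM_alg C R \<mu> \<iota>\<^esub> map_arr (free_alg R \<mu> C) f"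
      if "f \<in> Hom C a b" "g \<in> Hom C b c" for f g a b c
      using that P.L.map_arr_Comp[of g c b f a] by (simp add: free_alg_def EM_alg_def Let_def Hom_def)
  qed (fact Hom)
qed

end


section \<open>The mate monad of a comonad\<close>

locale comonad_adjunction = adjunction C C A + comonad C "ladj A" \<Delta> \<epsilon>
  for C :: "('o, 'm) category" and A :: "('o, 'm, 'o, 'm) adjunction" and \<Delta> \<epsilon> :: "'o \<Rightarrow> 'm"
begin

abbreviation "L \<equiv> ladj A"
abbreviation "R \<equiv> radj A"

definition "\<mu> = mate C A (comp_adjunction C C A A) \<Delta>"

definition "\<iota> = mate C A (id_adjunction C) \<epsilon>"

lemma \<mu>_Hom: "b \<in> Obj C \<Longrightarrow> \<mu> b \<in> Hom C (map_obj R (map_obj R b)) (map_obj R b)"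
  by (simp add: \<mu>_def mate_def comp_adjunction_def Hom_def)

lemma \<iota>_Hom: "b \<in> Obj C \<Longrightarrow> \<iota> b \<in> Hom C b (map_obj R b)"
  by (simp add: \<iota>_def mate_def id_adjunction_def Hom_def)

text \<open>The defining property of a mate: after transposing twice, composing with \<mu> amounts
  to precomposing with \<Delta>. The monad laws below are derived from this property, since by
  \<open>transpose2_surj\<close> every arrow into RRb is a double transpose.\<close>

lemma \<mu>_transpose:
  assumes a: "a \<in> Obj C" and f: "f \<in> Hom C (map_obj L (map_obj L a)) b"
  shows "\<mu> b \<cdot>\<^bsub>C\<^esub> transpose a (transpose (map_obj L a) f) = transpose a (f \<cdot>\<^bsub>C\<^esub> \<Delta> a)"
proof -
  let ?h = "transpose a (transpose (map_obj L a) f)"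
  have b: "b \<in> Obj C" using ladj.C.Hom_Obj[OF f] by blast
  have tf: "transpose (map_obj L a) f \<in> Hom C (map_obj L a) (map_obj R b)"
    using transpose_Hom f a by simp
  have h: "?h \<in> Hom C a (map_obj R (map_obj R b))"
    using transpose_Hom[OF a tf] .
  \<comment> \<open>This is the counit at b of the composite adjunction between LL and RR.\<close>
  let ?c = "untranspose b (adj_counit A (map_obj R b))"
  have c: "?c = adj_counit A b \<cdot>\<^bsub>C\<^esub> map_arr L (adj_counit A (map_obj R b))"
    by (simp add: untranspose_def)
  have "\<mu> b = transpose (map_obj R (map_obj R b)) (?c \<cdot>\<^bsub>C\<^esub> \<Delta> (map_obj R (map_obj R b)))"
    using b by (simp add: \<mu>_def mate_def comp_adjunction_def transpose_def c)
  then have "\<mu> b \<cdot>\<^bsub>C\<^esub> ?h = transpose a ((?c \<cdot>\<^bsub>C\<^esub> \<Delta> (map_obj R (map_obj R b))) \<cdot>\<^bsub>C\<^esub> map_arr L ?h)"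
    using transpose_precomp[OF _ h] b by (simp add: c Hom_def)
  also have "(?c \<cdot>\<^bsub>C\<^esub> \<Delta> (map_obj R (map_obj R b))) \<cdot>\<^bsub>C\<^esub> map_arr L ?h
      = (adj_counit A b \<cdot>\<^bsub>C\<^esub> map_arr L (untranspose (map_obj R b) ?h)) \<cdot>\<^bsub>C\<^esub> \<Delta> a"
    using a b h \<Delta>.naturality'[of ?h a] by (simp add: c untranspose_def[of "map_obj R b"] Hom_def)
  also have "adj_counit A b \<cdot>\<^bsub>C\<^esub> map_arr L (untranspose (map_obj R b) ?h) = f"
    using untranspose_transpose[OF tf a] untranspose_transpose[OF f] a by (simp add: untranspose_def[of b])
  finally show ?thesis .
qed

lemma \<iota>_transpose:
  assumes h: "h \<in> Hom C a b"
  shows "\<iota> b \<cdot>\<^bsub>C\<^esub> h = transpose a (h \<cdot>\<^bsub>C\<^esub> \<epsilon> a)"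
proof -
  have ab: "a \<in> Obj C" "b \<in> Obj C" using ladj.C.Hom_Obj[OF h] by auto
  have "\<iota> b = transpose b (\<epsilon> b)"
    using ab by (simp add: \<iota>_def mate_def id_adjunction_def transpose_def)
  then show ?thesis
    using ab h transpose_precomp[of "\<epsilon> b" b b h a] \<epsilon>.naturality'[of h a b] by (simp add: Hom_def)
qed

lemma transpose2_surj:
  assumes h: "h \<in> Hom C a (map_obj R (map_obj R b))" and b: "b \<in> Obj C"
  obtains f where "f \<in> Hom C (map_obj L (map_obj L a)) b" "h = transpose a (transpose (map_obj L a) f)"
  using that[of "untranspose b (untranspose (map_obj R b) h)"] b
    untranspose_Hom[OF _ untranspose_Hom[OF _ h]] transpose_untranspose[OF h]
    transpose_untranspose[OF untranspose_Hom[OF _ h]] by simp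

text \<open>Both sides are tested on the identity of RRb, written as a double transpose. There \<mu>
  acts by precomposition with \<Delta>, which commutes with postcomposition by k.\<close>

lemma \<mu>_natural:
  assumes k: "k \<in> Hom C b b'"
  shows "\<mu> b' \<cdot>\<^bsub>C\<^esub> map_arr R (map_arr R k) = map_arr R k \<cdot>\<^bsub>C\<^esub> \<mu> b"
proof -
  have b: "b \<in> Obj C" "b' \<in> Obj C" using ladj.C.Hom_Obj[OF k] by auto
  let ?a = "map_obj R (map_obj R b)"
  have a: "?a \<in> Obj C" using b by simp
  obtain f where f: "f \<in> Hom C (map_obj L (map_obj L ?a)) b"
    and id: "Id C ?a = transpose ?a (transpose (map_obj L ?a) f)"
    using transpose2_surj[OF ladj.C.Id_Hom[OF a] b(1)] .
  have tf: "transpose (map_obj L ?a) f \<in> Hom C (map_obj L ?a) (map_obj R b)"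
    using f a transpose_Hom by simp
  have \<Delta>: "\<Delta> ?a \<in> Hom C (map_obj L ?a) (map_obj L (map_obj L ?a))" using a by (simp add: Hom_def)
  have "\<mu> b' \<cdot>\<^bsub>C\<^esub> (map_arr R (map_arr R k) \<cdot>\<^bsub>C\<^esub> Id C ?a)
      = \<mu> b' \<cdot>\<^bsub>C\<^esub> transpose ?a (transpose (map_obj L ?a) (k \<cdot>\<^bsub>C\<^esub> f))"
    using transpose_postcomp[OF tf radj.map_arr_Hom[OF k] a] transpose_postcomp[OF f k] a
    by (simp add: id)
  also have "\<dots> = transpose ?a ((k \<cdot>\<^bsub>C\<^esub> f) \<cdot>\<^bsub>C\<^esub> \<Delta> ?a)"
    using \<mu>_transpose[OF a ladj.C.Comp_Hom[OF f k]] .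
  also have "\<dots> = map_arr R k \<cdot>\<^bsub>C\<^esub> transpose ?a (f \<cdot>\<^bsub>C\<^esub> \<Delta> ?a)"
    using transpose_postcomp[OF ladj.C.Comp_Hom[OF \<Delta> f] k a] ladj.C.Comp_assoc[OF \<Delta> f k] by simp
  also have "\<dots> = map_arr R k \<cdot>\<^bsub>C\<^esub> (\<mu> b \<cdot>\<^bsub>C\<^esub> Id C ?a)"
    using \<mu>_transpose[OF a f] id by simp
  finally show ?thesis
    using k \<mu>_Hom[OF b(1)] b by (simp add: Hom_def)
qed

lemma \<iota>_natural:
  assumes k: "k \<in> Hom C b b'"
  shows "\<iota> b' \<cdot>\<^bsub>C\<^esub> k = map_arr R k \<cdot>\<^bsub>C\<^esub> \<iota> b"
proof -
  have b: "b \<in> Obj C" "b' \<in> Obj C" using ladj.C.Hom_Obj[OF k] by auto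
  have "\<iota> b = transpose b (\<epsilon> b)"
    using \<iota>_transpose[OF ladj.C.Id_Hom[OF b(1)]] \<iota>_Hom[OF b(1)] b by (simp add: Hom_def)
  then show ?thesis
    using \<iota>_transpose[OF k] transpose_postcomp[OF _ k, of "\<epsilon> b" b] b by (simp add: Hom_def)
qed

text \<open>With the identity of RRRb written as the triple transpose of f, the two sides become the
  transposes of f \<Delta>L \<Delta> and f L\<Delta> \<Delta>, equal by coassociativity.\<close>

lemma \<mu>_assoc:
  assumes b: "b \<in> Obj C"
  shows "\<mu> b \<cdot>\<^bsub>C\<^esub> map_arr R (\<mu> b) = \<mu> b \<cdot>\<^bsub>C\<^esub> \<mu> (map_obj R b)"
proof -
  let ?a = "map_obj R (map_obj R (map_obj R b))"
  have a: "?a \<in> Obj C" using b by simp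
  let ?a1 = "map_obj L ?a" and ?a2 = "map_obj L (map_obj L ?a)"
  obtain g where g: "g \<in> Hom C ?a2 (map_obj R b)"
    and id: "Id C ?a = transpose ?a (transpose ?a1 g)"
    using transpose2_surj[OF ladj.C.Id_Hom[OF a]] b by auto
  define f where "f = untranspose b g"
  have f: "f \<in> Hom C (map_obj L ?a2) b" and gf: "g = transpose ?a2 f"
    using g b untranspose_Hom by (auto simp: f_def)
  have a': "?a1 \<in> Obj C" "?a2 \<in> Obj C" using a by auto
  have tg: "transpose ?a1 g \<in> Hom C ?a1 (map_obj R (map_obj R b))"
    using transpose_Hom g a by simp
  have f\<Delta>: "f \<cdot>\<^bsub>C\<^esub> \<Delta> ?a1 \<in> Hom C ?a2 b" "f \<cdot>\<^bsub>C\<^esub> map_arr L (\<Delta> ?a) \<in> Hom C ?a2 b"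
    using f a by (auto simp: Hom_def)
  have "\<mu> b \<cdot>\<^bsub>C\<^esub> (map_arr R (\<mu> b) \<cdot>\<^bsub>C\<^esub> Id C ?a)
      = \<mu> b \<cdot>\<^bsub>C\<^esub> transpose ?a (transpose ?a1 (f \<cdot>\<^bsub>C\<^esub> \<Delta> ?a1))"
    using transpose_postcomp[OF tg \<mu>_Hom[OF b] a] \<mu>_transpose[OF a'(1) f] by (simp add: id gf)
  also have "\<dots> = transpose ?a (f \<cdot>\<^bsub>C\<^esub> (\<Delta> ?a1 \<cdot>\<^bsub>C\<^esub> \<Delta> ?a))"
    using \<mu>_transpose[OF a f\<Delta>(1)] f a by (simp add: Hom_def)
  also have "\<dots> = transpose ?a ((f \<cdot>\<^bsub>C\<^esub> map_arr L (\<Delta> ?a)) \<cdot>\<^bsub>C\<^esub> \<Delta> ?a)"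
    using f a coassoc[OF a] by (simp add: Hom_def)
  also have "\<dots> = \<mu> b \<cdot>\<^bsub>C\<^esub> transpose ?a (transpose ?a1 (f \<cdot>\<^bsub>C\<^esub> map_arr L (\<Delta> ?a)))"
    using \<mu>_transpose[OF a f\<Delta>(2)] by simp
  also have "transpose ?a1 (f \<cdot>\<^bsub>C\<^esub> map_arr L (\<Delta> ?a)) = g \<cdot>\<^bsub>C\<^esub> \<Delta> ?a"
    using transpose_precomp[OF f, of "\<Delta> ?a" ?a1] a by (simp add: gf Hom_def)
  also have "transpose ?a (g \<cdot>\<^bsub>C\<^esub> \<Delta> ?a) = \<mu> (map_obj R b) \<cdot>\<^bsub>C\<^esub> Id C ?a"
    using \<mu>_transpose[OF a g] id by simp
  finally show ?thesis
    using b \<mu>_Hom[OF b] \<mu>_Hom[of "map_obj R b"] by (simp add: Hom_def)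
qed

text \<open>Mates reverse the order of the functors: the law with \<iota>R comes from the counit law
  for L\<epsilon>, and the law with R\<iota> from the one for \<epsilon>L.\<close>

lemma \<mu>_unit:
  assumes b: "b \<in> Obj C"
  shows "\<mu> b \<cdot>\<^bsub>C\<^esub> \<iota> (map_obj R b) = Id C (map_obj R b)"
    and "\<mu> b \<cdot>\<^bsub>C\<^esub> map_arr R (\<iota> b) = Id C (map_obj R b)"
proof -
  let ?a = "map_obj R b"
  have a: "?a \<in> Obj C" "map_obj L ?a \<in> Obj C" using b by auto
  define f where "f = untranspose b (Id C ?a)"
  have f: "f \<in> Hom C (map_obj L ?a) b" and id: "Id C ?a = transpose ?a f"
    using b untranspose_Hom[OF b, of "Id C ?a" ?a] transpose_untranspose[OF _ b, of "Id C ?a" ?a]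
    by (auto simp: f_def Hom_def)
  have f\<epsilon>: "f \<cdot>\<^bsub>C\<^esub> \<epsilon> (map_obj L ?a) \<in> Hom C (map_obj L (map_obj L ?a)) b"
    "f \<cdot>\<^bsub>C\<^esub> map_arr L (\<epsilon> ?a) \<in> Hom C (map_obj L (map_obj L ?a)) b"
    using f a by (auto simp: Hom_def)
  have "transpose ?a (transpose ?a f \<cdot>\<^bsub>C\<^esub> \<epsilon> ?a)
      = transpose ?a (transpose (map_obj L ?a) (f \<cdot>\<^bsub>C\<^esub> map_arr L (\<epsilon> ?a)))"
    using transpose_precomp[OF f, of "\<epsilon> ?a" "map_obj L ?a"] a by (simp add: Hom_def)
  then have "\<mu> b \<cdot>\<^bsub>C\<^esub> (\<iota> ?a \<cdot>\<^bsub>C\<^esub> Id C ?a) = transpose ?a f"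
    using \<iota>_transpose[OF ladj.C.Id_Hom[OF a(1)]] \<mu>_transpose[OF a(1) f\<epsilon>(2)] a f
    by (simp add: id Hom_def counit_right)
  then show "\<mu> b \<cdot>\<^bsub>C\<^esub> \<iota> ?a = Id C ?a"
    using \<iota>_Hom[OF a(1)] by (simp add: Hom_def flip: id)
  have "\<mu> b \<cdot>\<^bsub>C\<^esub> (map_arr R (\<iota> b) \<cdot>\<^bsub>C\<^esub> Id C ?a) = \<mu> b \<cdot>\<^bsub>C\<^esub> transpose ?a (\<iota> b \<cdot>\<^bsub>C\<^esub> f)"
    using transpose_postcomp[OF f \<iota>_Hom[OF b] a(1)] id by simp
  also have "\<dots> = transpose ?a f"
    using \<iota>_transpose[OF f] \<mu>_transpose[OF a(1) f\<epsilon>(1)] f a by (simp add: Hom_def counit_left)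
  finally show "\<mu> b \<cdot>\<^bsub>C\<^esub> map_arr R (\<iota> b) = Id C ?a"
    using \<mu>_Hom[OF b] \<iota>_Hom[OF b] b by (simp add: Hom_def flip: id)
qed

theorem comonad_op_cat: "comonad (op_cat C) R \<mu> \<iota>"
proof (rule comonad.intro)
  have "nat_transf C C (R \<odot> R) R \<mu>"
    using cat_functor_comp[OF radj_functor radj_functor] \<mu>_Hom \<mu>_natural
    by (simp add: nat_transf_def nat_transf_axioms_def radj_functor)
  then show "nat_transf (op_cat C) (op_cat C) R (R \<odot> R) \<mu>"
    by (rule nat_transf_op_cat)
  have "nat_transf C C id_functor R \<iota>"
    using cat_functor_id[OF ladj.C.category_axioms] \<iota>_Hom \<iota>_natural
    by (simp add: nat_transf_def nat_transf_axioms_def radj_functor)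
  then show "nat_transf (op_cat C) (op_cat C) R id_functor \<iota>"
    by (rule nat_transf_op_cat)
qed (use \<mu>_assoc \<mu>_unit in auto)

end


section \<open>Mates of coactions\<close>

text \<open>\<open>A\<close> is the adjunction of L and R that carries the comonad; \<open>K\<close>
  is the adjunction of I and J.\<close>

locale commuting_adjunction = comonad_adjunction C A \<Delta> \<epsilon> + K: adjunction C C K
  for C :: "('o, 'm) category" and A \<Delta> \<epsilon> and K :: "('o, 'm, 'o, 'm) adjunction" +
  assumes IL: "functor_eq C (ladj K \<odot> L) (L \<odot> ladj K)"
    and I\<Delta>: "a \<in> Obj C \<Longrightarrow> map_arr (ladj K) (\<Delta> a) = \<Delta> (map_obj (ladj K) a)"
    and I\<epsilon>: "a \<in> Obj C \<Longrightarrow> map_arr (ladj K) (\<epsilon> a) = \<epsilon> (map_obj (ladj K) a)"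
begin

abbreviation "I \<equiv> ladj K"
abbreviation "J \<equiv> radj K"

lemma IL_obj: "a \<in> Obj C \<Longrightarrow> map_obj I (map_obj L a) = map_obj L (map_obj I a)"
  using IL by (simp add: functor_eq_def)

lemma IL_arr: "f \<in> Arr C \<Longrightarrow> map_arr I (map_arr L f) = map_arr L (map_arr I f)"
  using IL by (simp add: functor_eq_def)

text \<open>\<open>\<delta> : I \<rightarrow> L I\<close> and \<open>\<gamma> : J R \<rightarrow> J\<close> are mates with respect to the adjunctions \<open>I \<stileturn> J\<close> and
  \<open>L I \<stileturn> J R\<close>: precomposition with \<open>\<delta>\<close> is transposed to postcomposition with \<open>\<gamma>\<close>.\<close>

definition mates :: "('o \<Rightarrow> 'm) \<Rightarrow> ('o \<Rightarrow> 'm) \<Rightarrow> bool" where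
  "mates \<delta> \<gamma> \<longleftrightarrow>
    (\<forall>a\<in>Obj C. \<delta> a \<in> Hom C (map_obj I a) (map_obj L (map_obj I a))) \<and>
    (\<forall>b\<in>Obj C. \<gamma> b \<in> Hom C (map_obj J (map_obj R b)) (map_obj J b)) \<and>
    (\<forall>a\<in>Obj C. \<forall>b\<in>Obj C. \<forall>f\<in>Hom C (map_obj L (map_obj I a)) b.
      \<gamma> b \<cdot>\<^bsub>C\<^esub> K.transpose a (transpose (map_obj I a) f) = K.transpose a (f \<cdot>\<^bsub>C\<^esub> \<delta> a))"

lemma transpose_I_Hom:
  "a \<in> Obj C \<Longrightarrow> f \<in> Hom C (map_obj L (map_obj I a)) b \<Longrightarrow>
    transpose (map_obj I a) f \<in> Hom C (map_obj I a) (map_obj R b)"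
  by (rule transpose_Hom) auto

text \<open>Commutation with I turns a map from I to IL into one from I to LI, the form that has a
  mate for the composite adjunction.\<close>

lemma coaction_iff:
  "coaction C C L \<epsilon> I \<delta> \<longleftrightarrow>
    (\<forall>a\<in>Obj C. \<delta> a \<in> Hom C (map_obj I a) (map_obj L (map_obj I a))) \<and>
    (\<forall>a b. \<forall>u\<in>Hom C a b. \<delta> b \<cdot>\<^bsub>C\<^esub> map_arr I u = map_arr L (map_arr I u) \<cdot>\<^bsub>C\<^esub> \<delta> a) \<and>
    (\<forall>a\<in>Obj C. \<epsilon> (map_obj I a) \<cdot>\<^bsub>C\<^esub> \<delta> a = Id C (map_obj I a))"
  using cat_functor_comp[OF ladj_functor K.ladj_functor]
  by (auto simp: coaction_def nat_transf_def nat_transf_axioms_def IL_obj IL_arr I\<epsilon>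
      K.ladj_functor Hom_def[of C])

lemma coaction_op_iff:
  "coaction (op_cat C) (op_cat C) R \<iota> J \<gamma> \<longleftrightarrow>
    (\<forall>b\<in>Obj C. \<gamma> b \<in> Hom C (map_obj J (map_obj R b)) (map_obj J b)) \<and>
    (\<forall>a b. \<forall>v\<in>Hom C a b. \<gamma> b \<cdot>\<^bsub>C\<^esub> map_arr J (map_arr R v) = map_arr J v \<cdot>\<^bsub>C\<^esub> \<gamma> a) \<and>
    (\<forall>b\<in>Obj C. \<gamma> b \<cdot>\<^bsub>C\<^esub> map_arr J (\<iota> b) = Id C (map_obj J b))"
proof -
  have "cat_functor (op_cat C) (op_cat C) J" "cat_functor (op_cat C) (op_cat C) (J \<odot> R)"
    using cat_functor_comp[OF radj_functor K.radj_functor] K.radj_functor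
    by (auto intro: cat_functor_op_cat)
  then show ?thesis
    by (auto simp: coaction_def nat_transf_def nat_transf_axioms_def)
qed

text \<open>Naturality is built into \<open>mates\<close>, which quantifies over all f. For \<delta>
  the relation is used at an identity and at LIu, for \<gamma> at an f whose double transpose is an
  identity and at v f.\<close>

lemma mates_natural:
  assumes m: "mates \<delta> \<gamma>"
  shows "u \<in> Hom C a b \<Longrightarrow> \<delta> b \<cdot>\<^bsub>C\<^esub> map_arr I u = map_arr L (map_arr I u) \<cdot>\<^bsub>C\<^esub> \<delta> a"
    and "v \<in> Hom C a b \<Longrightarrow> \<gamma> b \<cdot>\<^bsub>C\<^esub> map_arr J (map_arr R v) = map_arr J v \<cdot>\<^bsub>C\<^esub> \<gamma> a"
proof -
  have \<delta>: "\<delta> a \<in> Hom C (map_obj I a) (map_obj L (map_obj I a))" if "a \<in> Obj C" for a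
    using m that by (simp add: mates_def)
  have \<gamma>: "\<gamma> b \<in> Hom C (map_obj J (map_obj R b)) (map_obj J b)" if "b \<in> Obj C" for b
    using m that by (simp add: mates_def)
  have mate: "\<gamma> b \<cdot>\<^bsub>C\<^esub> K.transpose a (transpose (map_obj I a) f) = K.transpose a (f \<cdot>\<^bsub>C\<^esub> \<delta> a)"
    if "a \<in> Obj C" "b \<in> Obj C" "f \<in> Hom C (map_obj L (map_obj I a)) b" for a b f
    using m that by (simp add: mates_def)
  show "\<delta> b \<cdot>\<^bsub>C\<^esub> map_arr I u = map_arr L (map_arr I u) \<cdot>\<^bsub>C\<^esub> \<delta> a" if u: "u \<in> Hom C a b"
  proof -
    have ab: "a \<in> Obj C" "b \<in> Obj C" using ladj.C.Hom_Obj[OF u] by auto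
    let ?c = "map_obj L (map_obj I b)"
    have c: "?c \<in> Obj C" using ab by simp
    note id = ladj.C.Id_Hom[OF c]
    have LIu: "map_arr L (map_arr I u) \<in> Hom C (map_obj L (map_obj I a)) ?c"
      using u by (simp add: Hom_def)
    have "K.transpose a (\<delta> b \<cdot>\<^bsub>C\<^esub> map_arr I u) = K.transpose b (\<delta> b) \<cdot>\<^bsub>C\<^esub> u"
      using K.transpose_precomp[OF \<delta>[OF ab(2)] u] by simp
    also have "\<dots> = (\<gamma> ?c \<cdot>\<^bsub>C\<^esub> K.transpose b (transpose (map_obj I b) (Id C ?c))) \<cdot>\<^bsub>C\<^esub> u"
      using mate[OF ab(2) c id] \<delta>[OF ab(2)] by (simp add: Hom_def)
    also have "\<dots> = \<gamma> ?c \<cdot>\<^bsub>C\<^esub> (K.transpose b (transpose (map_obj I b) (Id C ?c)) \<cdot>\<^bsub>C\<^esub> u)"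
      using ladj.C.Comp_assoc[OF u K.transpose_Hom[OF ab(2) transpose_I_Hom[OF ab(2) id]] \<gamma>[OF c]] .
    also have "\<dots> = \<gamma> ?c \<cdot>\<^bsub>C\<^esub> K.transpose a (transpose (map_obj I a) (map_arr L (map_arr I u)))"
      using K.transpose_precomp[OF transpose_I_Hom[OF ab(2) id] u]
        transpose_precomp[OF id K.ladj.map_arr_Hom[OF u]] LIu by (simp add: Hom_def)
    also have "\<dots> = K.transpose a (map_arr L (map_arr I u) \<cdot>\<^bsub>C\<^esub> \<delta> a)"
      using mate[OF ab(1) c LIu] .
    finally show ?thesis
      by (rule K.transpose_inj[where b = ?c]) (use u \<delta> ab in \<open>auto simp: Hom_def\<close>)
  qed
  show "\<gamma> b \<cdot>\<^bsub>C\<^esub> map_arr J (map_arr R v) = map_arr J v \<cdot>\<^bsub>C\<^esub> \<gamma> a" if v: "v \<in> Hom C a b"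
  proof -
    have ab: "a \<in> Obj C" "b \<in> Obj C" using ladj.C.Hom_Obj[OF v] by auto
    let ?c = "map_obj J (map_obj R a)"
    have c: "?c \<in> Obj C" using ab by simp
    \<comment> \<open>Untransposing the identity of JRa along K and then along A produces f, the
      counit of the composite adjunction at a.\<close>
    define g where "g = K.untranspose (map_obj R a) (Id C ?c)"
    have g: "g \<in> Hom C (map_obj I ?c) (map_obj R a)" and idg: "K.transpose ?c g = Id C ?c"
      using K.untranspose_Hom[OF _ ladj.C.Id_Hom[OF c]] K.transpose_untranspose[OF ladj.C.Id_Hom[OF c]] ab
      by (auto simp: g_def)
    define f where "f = untranspose a g"
    have f: "f \<in> Hom C (map_obj L (map_obj I ?c)) a" and gf: "transpose (map_obj I ?c) f = g"
      using untranspose_Hom[OF ab(1) g] transpose_untranspose[OF g ab(1)] by (auto simp: f_def)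
    have vf: "v \<cdot>\<^bsub>C\<^esub> f \<in> Hom C (map_obj L (map_obj I ?c)) b" using ladj.C.Comp_Hom[OF f v] .
    have "\<gamma> b \<cdot>\<^bsub>C\<^esub> (map_arr J (map_arr R v) \<cdot>\<^bsub>C\<^esub> Id C ?c)
        = \<gamma> b \<cdot>\<^bsub>C\<^esub> K.transpose ?c (transpose (map_obj I ?c) (v \<cdot>\<^bsub>C\<^esub> f))"
      using K.transpose_postcomp[OF g radj.map_arr_Hom[OF v] c] transpose_postcomp[OF f v] c
      by (simp add: idg gf)
    also have "\<dots> = K.transpose ?c (v \<cdot>\<^bsub>C\<^esub> (f \<cdot>\<^bsub>C\<^esub> \<delta> ?c))"
      using mate[OF c ab(2) vf] ladj.C.Comp_assoc[OF \<delta>[OF c] f v] by simp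
    also have "\<dots> = map_arr J v \<cdot>\<^bsub>C\<^esub> (\<gamma> a \<cdot>\<^bsub>C\<^esub> Id C ?c)"
      using K.transpose_postcomp[OF ladj.C.Comp_Hom[OF \<delta>[OF c] f] v c] mate[OF c ab(1) f]
      by (simp add: idg gf)
    finally show ?thesis
      using v \<gamma>[OF ab(1)] by (simp add: Hom_def)
  qed
qed

text \<open>Composing transposes with \<gamma> J\<iota> amounts to precomposing with \<epsilon>I
  \<delta>. Either composite is an identity as soon as the other is, by choosing h to be the counit
  of K or an identity.\<close>

lemma mates_counit:
  assumes m: "mates \<delta> \<gamma>"
  shows "(\<forall>a\<in>Obj C. \<epsilon> (map_obj I a) \<cdot>\<^bsub>C\<^esub> \<delta> a = Id C (map_obj I a)) \<longleftrightarrow>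
    (\<forall>b\<in>Obj C. \<gamma> b \<cdot>\<^bsub>C\<^esub> map_arr J (\<iota> b) = Id C (map_obj J b))"
proof -
  have \<delta>: "\<delta> a \<in> Hom C (map_obj I a) (map_obj L (map_obj I a))" if "a \<in> Obj C" for a
    using m that by (simp add: mates_def)
  have \<gamma>: "\<gamma> b \<in> Hom C (map_obj J (map_obj R b)) (map_obj J b)" if "b \<in> Obj C" for b
    using m that by (simp add: mates_def)
  have key: "(\<gamma> b \<cdot>\<^bsub>C\<^esub> map_arr J (\<iota> b)) \<cdot>\<^bsub>C\<^esub> K.transpose a h
      = K.transpose a (h \<cdot>\<^bsub>C\<^esub> (\<epsilon> (map_obj I a) \<cdot>\<^bsub>C\<^esub> \<delta> a))"
    if a: "a \<in> Obj C" and h: "h \<in> Hom C (map_obj I a) b" for a b h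
  proof -
    have b: "b \<in> Obj C" using ladj.C.Hom_Obj[OF h] by auto
    have \<epsilon>: "\<epsilon> (map_obj I a) \<in> Hom C (map_obj L (map_obj I a)) (map_obj I a)" using a by (simp add: Hom_def)
    note h\<epsilon> = ladj.C.Comp_Hom[OF \<epsilon> h]
    have "(\<gamma> b \<cdot>\<^bsub>C\<^esub> map_arr J (\<iota> b)) \<cdot>\<^bsub>C\<^esub> K.transpose a h
        = \<gamma> b \<cdot>\<^bsub>C\<^esub> (map_arr J (\<iota> b) \<cdot>\<^bsub>C\<^esub> K.transpose a h)"
      using ladj.C.Comp_assoc[OF K.transpose_Hom[OF a h] K.radj.map_arr_Hom[OF \<iota>_Hom[OF b]] \<gamma>[OF b]] .
    also have "\<dots> = \<gamma> b \<cdot>\<^bsub>C\<^esub> K.transpose a (transpose (map_obj I a) (h \<cdot>\<^bsub>C\<^esub> \<epsilon> (map_obj I a)))"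
      using K.transpose_postcomp[OF h \<iota>_Hom[OF b] a] \<iota>_transpose[OF h] by simp
    also have "\<dots> = K.transpose a (h \<cdot>\<^bsub>C\<^esub> (\<epsilon> (map_obj I a) \<cdot>\<^bsub>C\<^esub> \<delta> a))"
      using m a b h\<epsilon> ladj.C.Comp_assoc[OF \<delta>[OF a] \<epsilon> h] by (simp add: mates_def)
    finally show ?thesis .
  qed
  show ?thesis
  proof (intro iffI ballI)
    fix b assume counit: "\<forall>a\<in>Obj C. \<epsilon> (map_obj I a) \<cdot>\<^bsub>C\<^esub> \<delta> a = Id C (map_obj I a)" and b: "b \<in> Obj C"
    let ?a = "map_obj J b"
    have a: "?a \<in> Obj C" using b by simp
    define h where "h = K.untranspose b (Id C ?a)"
    have h: "h \<in> Hom C (map_obj I ?a) b" and idh: "K.transpose ?a h = Id C ?a"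
      using K.untranspose_Hom[OF b ladj.C.Id_Hom[OF a]] K.transpose_untranspose[OF ladj.C.Id_Hom[OF a] b]
      by (auto simp: h_def)
    show "\<gamma> b \<cdot>\<^bsub>C\<^esub> map_arr J (\<iota> b) = Id C ?a"
      using key[OF a h] h counit a b \<gamma>[OF b] \<iota>_Hom[OF b] by (simp add: idh Hom_def)
  next
    fix a assume unit: "\<forall>b\<in>Obj C. \<gamma> b \<cdot>\<^bsub>C\<^esub> map_arr J (\<iota> b) = Id C (map_obj J b)" and a: "a \<in> Obj C"
    let ?b = "map_obj I a"
    have b: "?b \<in> Obj C" using a by simp
    have \<epsilon>\<delta>: "\<epsilon> ?b \<cdot>\<^bsub>C\<^esub> \<delta> a \<in> Hom C ?b ?b" using a \<delta> by (simp add: Hom_def)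
    note id = ladj.C.Id_Hom[OF b]
    have "K.transpose a (\<epsilon> ?b \<cdot>\<^bsub>C\<^esub> \<delta> a) = K.transpose a (Id C ?b)"
      using key[OF a id] unit b ladj.C.Id_Comp[OF K.transpose_Hom[OF a id]] ladj.C.Id_Comp[OF \<epsilon>\<delta>] by simp
    then show "\<epsilon> ?b \<cdot>\<^bsub>C\<^esub> \<delta> a = Id C ?b"
      by (rule K.transpose_inj[OF _ \<epsilon>\<delta> id a])
  qed
qed

text \<open>The mate of associativity of \<open>\<gamma>\<close> involves \<open>L \<delta>\<close>, whereas coassociativity of \<open>\<delta>\<close> involves
  \<open>\<delta> L\<close>.\<close>

lemma mates_coassociative:
  assumes m: "mates \<delta> \<gamma>"
  shows "coassociative (op_cat C) (op_cat C) R \<mu> J \<gamma> \<longleftrightarrow>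
    (\<forall>a\<in>Obj C. \<Delta> (map_obj I a) \<cdot>\<^bsub>C\<^esub> \<delta> a = map_arr L (\<delta> a) \<cdot>\<^bsub>C\<^esub> \<delta> a)"
proof -
  have \<delta>: "\<delta> a \<in> Hom C (map_obj I a) (map_obj L (map_obj I a))" if "a \<in> Obj C" for a
    using m that by (simp add: mates_def)
  have \<gamma>: "\<gamma> b \<in> Hom C (map_obj J (map_obj R b)) (map_obj J b)" if "b \<in> Obj C" for b
    using m that by (simp add: mates_def)
  have mate: "\<gamma> b \<cdot>\<^bsub>C\<^esub> K.transpose a (transpose (map_obj I a) f) = K.transpose a (f \<cdot>\<^bsub>C\<^esub> \<delta> a)"
    if "a \<in> Obj C" "b \<in> Obj C" "f \<in> Hom C (map_obj L (map_obj I a)) b" for a b f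
    using m that by (simp add: mates_def)
  \<comment> \<open>On triple transposes, \<gamma> J\<mu> acts as precomposition with \<Delta>I
    \<delta>, and \<gamma> \<gamma>R as precomposition with L\<delta> \<delta>.\<close>
  have key:
    "(\<gamma> b \<cdot>\<^bsub>C\<^esub> map_arr J (\<mu> b)) \<cdot>\<^bsub>C\<^esub>
        K.transpose a (transpose (map_obj I a) (transpose (map_obj L (map_obj I a)) f))
      = K.transpose a (f \<cdot>\<^bsub>C\<^esub> (\<Delta> (map_obj I a) \<cdot>\<^bsub>C\<^esub> \<delta> a))" (is ?th1)
    "(\<gamma> b \<cdot>\<^bsub>C\<^esub> \<gamma> (map_obj R b)) \<cdot>\<^bsub>C\<^esub>
        K.transpose a (transpose (map_obj I a) (transpose (map_obj L (map_obj I a)) f))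
      = K.transpose a (f \<cdot>\<^bsub>C\<^esub> (map_arr L (\<delta> a) \<cdot>\<^bsub>C\<^esub> \<delta> a))" (is ?th2)
    if a: "a \<in> Obj C" and f: "f \<in> Hom C (map_obj L (map_obj L (map_obj I a))) b" for a b f
  proof -
    let ?a = "map_obj I a"
    let ?f1 = "transpose (map_obj L ?a) f"
    let ?f2 = "transpose ?a ?f1"
    have b: "b \<in> Obj C" "map_obj R b \<in> Obj C" using ladj.C.Hom_Obj[OF f] by auto
    have a': "?a \<in> Obj C" "map_obj L ?a \<in> Obj C" using a by auto
    have \<Delta>: "\<Delta> ?a \<in> Hom C (map_obj L ?a) (map_obj L (map_obj L ?a))" using a by (simp add: Hom_def)
    have f1: "?f1 \<in> Hom C (map_obj L ?a) (map_obj R b)" using transpose_Hom[OF a'(2) f] .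
    have f2: "?f2 \<in> Hom C ?a (map_obj R (map_obj R b))" using transpose_Hom[OF a'(1) f1] .
    note f3 = K.transpose_Hom[OF a f2]
    note L\<delta> = ladj.map_arr_Hom[OF \<delta>[OF a]]
    have "(\<gamma> b \<cdot>\<^bsub>C\<^esub> map_arr J (\<mu> b)) \<cdot>\<^bsub>C\<^esub> K.transpose a ?f2
        = \<gamma> b \<cdot>\<^bsub>C\<^esub> K.transpose a (\<mu> b \<cdot>\<^bsub>C\<^esub> ?f2)"
      using ladj.C.Comp_assoc[OF f3 K.radj.map_arr_Hom[OF \<mu>_Hom[OF b(1)]] \<gamma>[OF b(1)]]
        K.transpose_postcomp[OF f2 \<mu>_Hom[OF b(1)] a] by simp
    also have "\<dots> = K.transpose a ((f \<cdot>\<^bsub>C\<^esub> \<Delta> ?a) \<cdot>\<^bsub>C\<^esub> \<delta> a)"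
      using \<mu>_transpose[OF a'(1) f] mate[OF a b(1) ladj.C.Comp_Hom[OF \<Delta> f]] by simp
    finally show ?th1
      using ladj.C.Comp_assoc[OF \<delta>[OF a] \<Delta> f] by simp
    have "(\<gamma> b \<cdot>\<^bsub>C\<^esub> \<gamma> (map_obj R b)) \<cdot>\<^bsub>C\<^esub> K.transpose a ?f2
        = \<gamma> b \<cdot>\<^bsub>C\<^esub> K.transpose a (?f1 \<cdot>\<^bsub>C\<^esub> \<delta> a)"
      using ladj.C.Comp_assoc[OF f3 \<gamma>[OF b(2)] \<gamma>[OF b(1)]] mate[OF a b(2) f1] by simp
    also have "\<dots> = K.transpose a ((f \<cdot>\<^bsub>C\<^esub> map_arr L (\<delta> a)) \<cdot>\<^bsub>C\<^esub> \<delta> a)"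
      using transpose_precomp[OF f \<delta>[OF a]] mate[OF a b(1) ladj.C.Comp_Hom[OF L\<delta> f]] by simp
    finally show ?th2
      using ladj.C.Comp_assoc[OF \<delta>[OF a] L\<delta> f] by simp
  qed
  have "(\<forall>b\<in>Obj C. \<gamma> b \<cdot>\<^bsub>C\<^esub> map_arr J (\<mu> b) = \<gamma> b \<cdot>\<^bsub>C\<^esub> \<gamma> (map_obj R b)) \<longleftrightarrow>
    (\<forall>a\<in>Obj C. \<Delta> (map_obj I a) \<cdot>\<^bsub>C\<^esub> \<delta> a = map_arr L (\<delta> a) \<cdot>\<^bsub>C\<^esub> \<delta> a)"
  proof (intro iffI ballI)
    fix a assume assoc: "\<forall>b\<in>Obj C. \<gamma> b \<cdot>\<^bsub>C\<^esub> map_arr J (\<mu> b) = \<gamma> b \<cdot>\<^bsub>C\<^esub> \<gamma> (map_obj R b)"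
      and a: "a \<in> Obj C"
    let ?b = "map_obj L (map_obj L (map_obj I a))"
    have b: "?b \<in> Obj C" using a by simp
    have h: "\<Delta> (map_obj I a) \<cdot>\<^bsub>C\<^esub> \<delta> a \<in> Hom C (map_obj I a) ?b"
      "map_arr L (\<delta> a) \<cdot>\<^bsub>C\<^esub> \<delta> a \<in> Hom C (map_obj I a) ?b"
      using a \<delta>[OF a] by (auto simp: Hom_def)
    have "K.transpose a (\<Delta> (map_obj I a) \<cdot>\<^bsub>C\<^esub> \<delta> a) = K.transpose a (map_arr L (\<delta> a) \<cdot>\<^bsub>C\<^esub> \<delta> a)"
      using key[OF a ladj.C.Id_Hom[OF b]] assoc b ladj.C.Id_Comp[OF h(1)] ladj.C.Id_Comp[OF h(2)]
      by simp
    then show "\<Delta> (map_obj I a) \<cdot>\<^bsub>C\<^esub> \<delta> a = map_arr L (\<delta> a) \<cdot>\<^bsub>C\<^esub> \<delta> a"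
      by (rule K.transpose_inj[OF _ h a])
  next
    fix b assume coassoc: "\<forall>a\<in>Obj C. \<Delta> (map_obj I a) \<cdot>\<^bsub>C\<^esub> \<delta> a = map_arr L (\<delta> a) \<cdot>\<^bsub>C\<^esub> \<delta> a"
      and b: "b \<in> Obj C"
    let ?a = "map_obj J (map_obj R (map_obj R b))"
    have a: "?a \<in> Obj C" using b by simp
    \<comment> \<open>The identity of JRRb is written as a triple transpose, so that
      \<open>key\<close> determines both composites outright.\<close>
    define g where "g = K.untranspose (map_obj R (map_obj R b)) (Id C ?a)"
    have g: "g \<in> Hom C (map_obj I ?a) (map_obj R (map_obj R b))" and idg: "K.transpose ?a g = Id C ?a"
      using K.untranspose_Hom[OF _ ladj.C.Id_Hom[OF a]] K.transpose_untranspose[OF ladj.C.Id_Hom[OF a]] b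
      by (auto simp: g_def)
    obtain f where f: "f \<in> Hom C (map_obj L (map_obj L (map_obj I ?a))) b"
      and gf: "g = transpose (map_obj I ?a) (transpose (map_obj L (map_obj I ?a)) f)"
      using transpose2_surj[OF g b] .
    have "(\<gamma> b \<cdot>\<^bsub>C\<^esub> map_arr J (\<mu> b)) \<cdot>\<^bsub>C\<^esub> Id C ?a = (\<gamma> b \<cdot>\<^bsub>C\<^esub> \<gamma> (map_obj R b)) \<cdot>\<^bsub>C\<^esub> Id C ?a"
      using key[OF a f] coassoc a by (simp add: idg flip: gf)
    then show "\<gamma> b \<cdot>\<^bsub>C\<^esub> map_arr J (\<mu> b) = \<gamma> b \<cdot>\<^bsub>C\<^esub> \<gamma> (map_obj R b)"
      using b \<gamma>[of b] \<gamma>[of "map_obj R b"] \<mu>_Hom[OF b] by (simp add: Hom_def)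
  qed
  then show ?thesis
    by (simp add: coassociative_def)
qed

text \<open>This is where fullness enters: it bridges the gap between \<delta>L in coassociativity
  and L\<delta> in the mate of associativity.\<close>

lemma mates_full:
  assumes m: "mates \<delta> \<gamma>" and full: "full_functor C C I \<or> full_functor C C J" and a: "a \<in> Obj C"
  shows "\<delta> (map_obj L a) \<cdot>\<^bsub>C\<^esub> \<delta> a = map_arr L (\<delta> a) \<cdot>\<^bsub>C\<^esub> \<delta> a"
  using full
proof
  have \<delta>: "\<delta> a \<in> Hom C (map_obj I a) (map_obj L (map_obj I a))" if "a \<in> Obj C" for a
    using m that by (simp add: mates_def)
  {
    assume "full_functor C C I"
    then obtain d where d: "d \<in> Hom C a (map_obj L a)" "map_arr I d = \<delta> a"
      using \<delta>[OF a] a IL_obj[OF a] unfolding full_functor_def by (metis ladj.map_obj_Obj)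
    then show ?thesis
      using mates_natural(1)[OF m d(1)] by simp
  next
    assume J: "full_functor C C J"
    have "\<forall>b\<in>Obj C. \<exists>c. c \<in> Hom C (map_obj R b) b \<and> map_arr J c = \<gamma> b"
      using J m unfolding full_functor_def mates_def by (meson radj.map_obj_Obj)
    then obtain c where c: "\<And>b. b \<in> Obj C \<Longrightarrow> c b \<in> Hom C (map_obj R b) b"
      and Jc: "\<And>b. b \<in> Obj C \<Longrightarrow> map_arr J (c b) = \<gamma> b"
      by metis
    \<comment> \<open>Since \<gamma> is the image under J of the arrows \<open>c b\<close>, the mate
      relation is an equation between transposes along K, and injectivity of transposition removes
      J.\<close>
    have *: "f \<cdot>\<^bsub>C\<^esub> \<delta> a = c b \<cdot>\<^bsub>C\<^esub> transpose (map_obj I a) f"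
      if a: "a \<in> Obj C" and f: "f \<in> Hom C (map_obj L (map_obj I a)) b" for a b f
    proof -
      have b: "b \<in> Obj C" using ladj.C.Hom_Obj[OF f] by auto
      note tf = transpose_I_Hom[OF a f]
      have "K.transpose a (f \<cdot>\<^bsub>C\<^esub> \<delta> a) = K.transpose a (c b \<cdot>\<^bsub>C\<^esub> transpose (map_obj I a) f)"
        using m a b f K.transpose_postcomp[OF tf c[OF b] a] by (simp add: mates_def Jc)
      then show ?thesis
        by (rule K.transpose_inj[OF _ ladj.C.Comp_Hom[OF \<delta>[OF a] f] ladj.C.Comp_Hom[OF tf c[OF b]] a])
    qed
    let ?b = "map_obj L (map_obj L (map_obj I a))"
    have b: "?b \<in> Obj C" using a by simp
    have La: "map_obj L a \<in> Obj C" using a by simp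
    have eq: "map_obj I (map_obj L a) = map_obj L (map_obj I a)" using IL_obj[OF a] .
    \<comment> \<open>The identity of LLIa is viewed as an arrow out of LI(La), which uses IL = LI
      on objects.\<close>
    have id: "Id C ?b \<in> Hom C (map_obj L (map_obj I (map_obj L a))) ?b"
      using ladj.C.Id_Hom[OF b] by (simp add: eq)
    note t = transpose_I_Hom[OF La id]
    note \<delta>a = \<delta>[OF a, folded eq]
    have "\<delta> (map_obj L a) = c ?b \<cdot>\<^bsub>C\<^esub> transpose (map_obj I (map_obj L a)) (Id C ?b)"
      using *[OF La id] ladj.C.Id_Comp[OF \<delta>[OF La]] by (simp add: eq)
    then have "\<delta> (map_obj L a) \<cdot>\<^bsub>C\<^esub> \<delta> a
        = c ?b \<cdot>\<^bsub>C\<^esub> (transpose (map_obj I (map_obj L a)) (Id C ?b) \<cdot>\<^bsub>C\<^esub> \<delta> a)"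
      using ladj.C.Comp_assoc[OF \<delta>a t c[OF b]] by simp
    also have "\<dots> = c ?b \<cdot>\<^bsub>C\<^esub> transpose (map_obj I a) (map_arr L (\<delta> a))"
      using transpose_precomp[OF id \<delta>a] ladj.C.Id_Comp[OF ladj.map_arr_Hom[OF \<delta>[OF a]]] by simp
    also have "\<dots> = map_arr L (\<delta> a) \<cdot>\<^bsub>C\<^esub> \<delta> a"
      using *[OF a ladj.map_arr_Hom[OF \<delta>[OF a]]] by simp
    finally show ?thesis .
  }
qed

lemma mates_coaction:
  "mates \<delta> \<gamma> \<Longrightarrow> coaction C C L \<epsilon> I \<delta> \<longleftrightarrow> coaction (op_cat C) (op_cat C) R \<iota> J \<gamma>"
  using mates_natural[of \<delta> \<gamma>] mates_counit[of \<delta> \<gamma>]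
  unfolding coaction_iff coaction_op_iff by (auto simp: mates_def)

text \<open>Replacing I\<Delta> by \<Delta>I, and \<delta>L \<delta> by L\<delta> \<delta>, turns
  coassociativity into the condition of \<open>mates_coassociative\<close>.\<close>

lemma mates_coassociative_iff:
  assumes "mates \<delta> \<gamma>" "full_functor C C I \<or> full_functor C C J"
  shows "coassociative C C L \<Delta> I \<delta> \<longleftrightarrow> coassociative (op_cat C) (op_cat C) R \<mu> J \<gamma>"
  using mates_coassociative[OF assms(1)] mates_full[OF assms] by (simp add: coassociative_def I\<Delta>)

lemma mate_of_coaction:
  assumes "coaction C C L \<epsilon> I \<delta>"
  obtains \<gamma> where "mates \<delta> \<gamma>"
proof -
  have \<delta>: "\<delta> a \<in> Hom C (map_obj I a) (map_obj L (map_obj I a))" if "a \<in> Obj C" for a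
    using assms that by (simp add: coaction_iff)
  have natural: "\<delta> b \<cdot>\<^bsub>C\<^esub> map_arr I u = map_arr L (map_arr I u) \<cdot>\<^bsub>C\<^esub> \<delta> a" if "u \<in> Hom C a b" for a b u
    using assms that by (simp add: coaction_iff)
  \<comment> \<open>\<open>f b\<close> is the counit of the composite adjunction of LI and JR. Its
    double transpose is an identity, so the mate relation at \<open>f b\<close> forces the choice of
    \<open>\<gamma> b\<close>.\<close>
  define f where "f b = untranspose b (K.untranspose (map_obj R b) (Id C (map_obj J (map_obj R b))))" for b
  define \<gamma> where "\<gamma> b = K.transpose (map_obj J (map_obj R b)) (f b \<cdot>\<^bsub>C\<^esub> \<delta> (map_obj J (map_obj R b)))" for b
  have f: "f b \<in> Hom C (map_obj L (map_obj I (map_obj J (map_obj R b)))) b" if "b \<in> Obj C" for b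
    using that unfolding f_def by (intro untranspose_Hom K.untranspose_Hom ladj.C.Id_Hom) auto
  have \<gamma>: "\<gamma> b \<in> Hom C (map_obj J (map_obj R b)) (map_obj J b)" if "b \<in> Obj C" for b
    unfolding \<gamma>_def using that by (intro K.transpose_Hom ladj.C.Comp_Hom[OF \<delta> f]) auto
  have "\<gamma> b \<cdot>\<^bsub>C\<^esub> K.transpose a (transpose (map_obj I a) h) = K.transpose a (h \<cdot>\<^bsub>C\<^esub> \<delta> a)"
    if a: "a \<in> Obj C" and b: "b \<in> Obj C" and h: "h \<in> Hom C (map_obj L (map_obj I a)) b" for a b h
  proof -
    let ?c = "map_obj J (map_obj R b)"
    let ?t = "K.transpose a (transpose (map_obj I a) h)"
    have c: "?c \<in> Obj C" "map_obj R b \<in> Obj C" using b by auto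
    note th = transpose_I_Hom[OF a h]
    have t: "?t \<in> Hom C a ?c" using K.transpose_Hom[OF a th] .
    note It = K.ladj.map_arr_Hom[OF t]
    have "\<gamma> b \<cdot>\<^bsub>C\<^esub> ?t = K.transpose a ((f b \<cdot>\<^bsub>C\<^esub> \<delta> ?c) \<cdot>\<^bsub>C\<^esub> map_arr I ?t)"
      unfolding \<gamma>_def using K.transpose_precomp[OF ladj.C.Comp_Hom[OF \<delta>[OF c(1)] f[OF b]] t] .
    also have "(f b \<cdot>\<^bsub>C\<^esub> \<delta> ?c) \<cdot>\<^bsub>C\<^esub> map_arr I ?t = (f b \<cdot>\<^bsub>C\<^esub> map_arr L (map_arr I ?t)) \<cdot>\<^bsub>C\<^esub> \<delta> a"
      using ladj.C.Comp_assoc[OF It \<delta>[OF c(1)] f[OF b]] natural[OF t]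
        ladj.C.Comp_assoc[OF \<delta>[OF a] ladj.map_arr_Hom[OF It] f[OF b]] by simp
    \<comment> \<open>Composing the counit with LI of an arrow untransposes that arrow along both
      adjunctions, which here recovers h.\<close>
    also have "f b \<cdot>\<^bsub>C\<^esub> map_arr L (map_arr I ?t) = untranspose b (K.untranspose (map_obj R b) ?t)"
      using b It K.ladj.map_arr_Hom[OF t]
      by (simp add: f_def untranspose_def K.untranspose_def Hom_def)
    also have "\<dots> = h"
      using K.untranspose_transpose[OF th a] untranspose_transpose[OF h] a by simp
    finally show ?thesis .
  qed
  then have "mates \<delta> \<gamma>"
    using \<delta> \<gamma> by (simp add: mates_def)
  then show thesis
    by (rule that)
qed

lemma mate_of_coaction_op:
  assumes "coaction (op_cat C) (op_cat C) R \<iota> J \<gamma>"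
  obtains \<delta> where "mates \<delta> \<gamma>"
proof -
  have \<gamma>: "\<gamma> b \<in> Hom C (map_obj J (map_obj R b)) (map_obj J b)" if "b \<in> Obj C" for b
    using assms that by (simp add: coaction_op_iff)
  have natural: "\<gamma> b \<cdot>\<^bsub>C\<^esub> map_arr J (map_arr R v) = map_arr J v \<cdot>\<^bsub>C\<^esub> \<gamma> a" if "v \<in> Hom C a b" for a b v
    using assms that by (simp add: coaction_op_iff)
  \<comment> \<open>\<open>T a\<close> is the unit of the composite adjunction, and the mate
    relation at the identity of LIa forces the choice of \<open>\<delta> a\<close>.\<close>
  define T where "T a = K.transpose a (transpose (map_obj I a) (Id C (map_obj L (map_obj I a))))" for a
  define \<delta> where "\<delta> a = K.untranspose (map_obj L (map_obj I a)) (\<gamma> (map_obj L (map_obj I a)) \<cdot>\<^bsub>C\<^esub> T a)" for a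
  have T: "T a \<in> Hom C a (map_obj J (map_obj R (map_obj L (map_obj I a))))" if "a \<in> Obj C" for a
    unfolding T_def using that by (intro K.transpose_Hom transpose_I_Hom ladj.C.Id_Hom) auto
  have \<gamma>T: "\<gamma> (map_obj L (map_obj I a)) \<cdot>\<^bsub>C\<^esub> T a \<in> Hom C a (map_obj J (map_obj L (map_obj I a)))"
    if "a \<in> Obj C" for a
    using that by (intro ladj.C.Comp_Hom[OF T \<gamma>]) auto
  have \<delta>: "\<delta> a \<in> Hom C (map_obj I a) (map_obj L (map_obj I a))" if "a \<in> Obj C" for a
    unfolding \<delta>_def using that by (intro K.untranspose_Hom \<gamma>T) auto
  have "\<gamma> b \<cdot>\<^bsub>C\<^esub> K.transpose a (transpose (map_obj I a) h) = K.transpose a (h \<cdot>\<^bsub>C\<^esub> \<delta> a)"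
    if a: "a \<in> Obj C" and b: "b \<in> Obj C" and h: "h \<in> Hom C (map_obj L (map_obj I a)) b" for a b h
  proof -
    let ?c = "map_obj L (map_obj I a)"
    have c: "?c \<in> Obj C" "map_obj I a \<in> Obj C" using a by auto
    note id = ladj.C.Id_Hom[OF c(1)]
    have "K.transpose a (h \<cdot>\<^bsub>C\<^esub> \<delta> a) = map_arr J h \<cdot>\<^bsub>C\<^esub> (\<gamma> ?c \<cdot>\<^bsub>C\<^esub> T a)"
      using K.transpose_postcomp[OF \<delta>[OF a] h a] K.transpose_untranspose[OF \<gamma>T[OF a] c(1)]
      by (simp add: \<delta>_def)
    also have "\<dots> = \<gamma> b \<cdot>\<^bsub>C\<^esub> (map_arr J (map_arr R h) \<cdot>\<^bsub>C\<^esub> T a)"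
      using natural[OF h] ladj.C.Comp_assoc[OF T[OF a] \<gamma>[OF c(1)] K.radj.map_arr_Hom[OF h]]
        ladj.C.Comp_assoc[OF T[OF a] K.radj.map_arr_Hom[OF radj.map_arr_Hom[OF h]] \<gamma>[OF b]] by simp
    also have "map_arr J (map_arr R h) \<cdot>\<^bsub>C\<^esub> T a = K.transpose a (transpose (map_obj I a) h)"
      using K.transpose_postcomp[OF transpose_I_Hom[OF a id] radj.map_arr_Hom[OF h] a]
        transpose_postcomp[OF id h c(2)] ladj.C.Comp_Id[OF h] by (simp add: T_def)
    finally show ?thesis by simp
  qed
  then have "mates \<delta> \<gamma>"
    using \<delta> \<gamma> by (simp add: mates_def)
  then show thesis
    by (rule that)
qed

theorem ex_coaction_iff:
  "(\<exists>\<delta>. coaction C C L \<epsilon> I \<delta>) \<longleftrightarrow> (\<exists>\<gamma>. coaction (op_cat C) (op_cat C) R \<iota> J \<gamma>)"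
  by (meson mate_of_coaction mate_of_coaction_op mates_coaction)

theorem ex_coassociative_coaction_iff:
  assumes "full_functor C C I \<or> full_functor C C J"
  shows "(\<exists>\<delta>. coaction C C L \<epsilon> I \<delta> \<and> coassociative C C L \<Delta> I \<delta>) \<longleftrightarrow>
    (\<exists>\<gamma>. coaction (op_cat C) (op_cat C) R \<iota> J \<gamma> \<and> coassociative (op_cat C) (op_cat C) R \<mu> J \<gamma>)"
  by (meson assms mate_of_coaction mate_of_coaction_op mates_coaction mates_coassociative_iff)

section \<open>Transfer between the comonad side and the monad side\<close>

text \<open>Only presentations enter, so the same two equivalences serve the Eilenberg-Moore
  categories and arbitrary adjunctions inducing L and R.\<close>

lemma
  assumes D: "comonad_presentation C L \<Delta> \<epsilon> D F t"
    and D': "cat_functor C D' F'" "comonad_presentation (op_cat C) R \<mu> \<iota> (op_cat D') F' t'"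
  shows separable_iff: "separable C D C F I \<longleftrightarrow> separable C D' C F' J"
    and heavily_separable_iff: "full_functor C C I \<or> full_functor C C J \<Longrightarrow>
      heavily_separable C D C F I \<longleftrightarrow> heavily_separable C D' C F' J"
proof -
  interpret F: separability C L \<Delta> \<epsilon> D F t C I
    using D K.ladj_functor by (rule separability.intro)
  interpret F': separability "op_cat C" R \<mu> \<iota> "op_cat D'" F' t' "op_cat C" J
    using D'(2) cat_functor_op_cat[OF K.radj_functor] by (rule separability.intro)
  note op = separable_op_cat[OF D'(1) K.radj_functor] heavily_separable_op_cat[OF D'(1) K.radj_functor]
  show "separable C D C F I \<longleftrightarrow> separable C D' C F' J"
    using F.separable_iff F'.separable_iff ex_coaction_iff op(1) by simp
  show "heavily_separable C D C F I \<longleftrightarrow> heavily_separable C D' C F' J"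
    if "full_functor C C I \<or> full_functor C C J"
    using F.heavily_separable_iff F'.heavily_separable_iff ex_coassociative_coaction_iff[OF that] op(2)
    by simp
qed

end

section \<open>The three equivalences\<close>

theorem theorem4p3:
  fixes C :: "('o, 'm) category"
    and L R I J :: "('o, 'm, 'o, 'm) cat_functor"
    and LR IJ :: "('o, 'm, 'o, 'm) adjunction"
    and \<Delta> \<epsilon> \<mu> \<iota> :: "'o \<Rightarrow> 'm"
  assumes LR: "adjunction C C LR" "ladj LR = L" "radj LR = R"
    and L: "comonad C L \<Delta> \<epsilon>"
    and \<mu>: "\<mu> = mate C LR (comp_adjunction C C LR LR) \<Delta>"
    and \<iota>: "\<iota> = mate C LR (id_adjunction C) \<epsilon>"
    and IJ: "adjunction C C IJ" "ladj IJ = I" "radj IJ = J"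
    and IL: "functor_eq C (I \<odot> L) (L \<odot> I)"
    and I\<Delta>: "\<forall>x\<in>Obj C. map_arr I (\<Delta> x) = \<Delta> (map_obj I x)"
    and I\<epsilon>: "\<forall>x\<in>Obj C. map_arr I (\<epsilon> x) = \<epsilon> (map_obj I x)"
  shows "(separable C (EM_coalg C L \<Delta> \<epsilon>) C (cofree_coalg L \<Delta> C) I \<longleftrightarrow>
          separable C (EM_alg C R \<mu> \<iota>) C (free_alg R \<mu> C) J)
      \<and> (full_functor C C I \<or> full_functor C C J \<longrightarrow>
          (heavily_separable C (EM_coalg C L \<Delta> \<epsilon>) C (cofree_coalg L \<Delta> C) I \<longleftrightarrow>
           heavily_separable C (EM_alg C R \<mu> \<iota>) C (free_alg R \<mu> C) J))
      \<and> (\<forall>(A :: ('a, 'am) category) (B :: ('b, 'bm) category) P Q' P' Q PQ' P'Q.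
          adjunction C A PQ' \<and> ladj PQ' = P \<and> radj PQ' = Q' \<and> has_monad C PQ' R \<mu> \<iota> \<and>
          adjunction B C P'Q \<and> ladj P'Q = P' \<and> radj P'Q = Q \<and> has_comonad C P'Q L \<Delta> \<epsilon> \<and>
          (full_functor C C I \<or> full_functor C C J) \<longrightarrow>
          (heavily_separable C B C Q I \<longleftrightarrow> heavily_separable C A C P J))"
proof -
  interpret T: commuting_adjunction C LR \<Delta> \<epsilon> IJ
    using assms by (simp add: commuting_adjunction_def comonad_adjunction_def commuting_adjunction_axioms_def)
  have \<mu>\<iota>: "T.\<mu> = \<mu>" "T.\<iota> = \<iota>"
    using \<mu> \<iota> by (simp_all add: T.\<mu>_def T.\<iota>_def)
  note comonad = T.comonad_op_cat[unfolded \<mu>\<iota> LR]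
  note C = T.ladj.C.category_axioms
  note sep = T.separable_iff[unfolded \<mu>\<iota> LR IJ] T.heavily_separable_iff[unfolded \<mu>\<iota> LR IJ]
  note EM = comonad.comonad_presentation_EM_coalg[OF L] cat_functor_free_alg[OF comonad C]
    comonad_presentation_EM_alg[OF comonad C]
  have "heavily_separable C B C Q I \<longleftrightarrow> heavily_separable C A C P J"
    if PQ': "adjunction C A PQ'" "ladj PQ' = P" "has_monad C PQ' R \<mu> \<iota>"
      and P'Q: "adjunction B C P'Q" "radj P'Q = Q" "has_comonad C P'Q L \<Delta> \<epsilon>"
      and full: "full_functor C C I \<or> full_functor C C J"
    for A :: "('a, 'am) category" and B :: "('b, 'bm) category" and P Q PQ' P'Q
  proof (rule sep(2)[OF _ _ _ full])
    show "comonad_presentation C L \<Delta> \<epsilon> B Q (\<lambda>a b. adjunction.untranspose C P'Q b)"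
      using comonad.comonad_presentation_adjunction[OF L P'Q(1,3)] P'Q(2) by simp
    show "cat_functor C A P"
      using adjunction.ladj_functor[OF PQ'(1)] PQ'(2) by simp
    \<comment> \<open>The left adjoint P is the right adjoint of the opposite adjunction, whose
      comonad over \<open>op_cat C\<close> is the monad R.\<close>
    show "comonad_presentation (op_cat C) R \<mu> \<iota> (op_cat A) P
        (\<lambda>a b. adjunction.untranspose (op_cat C) (op_adjunction PQ') b)"
      using comonad.comonad_presentation_adjunction[OF comonad adjunction_op_cat[OF PQ'(1)]
          has_monad_op_cat[OF PQ'(3)]] PQ'(2) by simp
  qed
  then show ?thesis
    using sep[OF EM] by blast
qed

end
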